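(* Let $G$ be a finite group, let $H<G$ be a subgroup, and let $C_1,\dots,C_k$ be the non-identity conjugacy classes of $G$. Then 1. $\displaystyle \sum_{i=1}^k |C_i\cap H|^2\,|H|^{-1}|C_i|^{-1}< D_H$; 2. $\displaystyle D_H\le \sum_{i=1}^k |C_i\cap H|\,|C_i|^{-1/2}=\sum_{1\ne h\in H}|h^G|^{-1/2}$.
   Context: $\mathrm{Irr}(G)$ is the set of complex irreducible representations of $G$ up to equivalence; for $\rho\in \mathrm{Irr}(G)$, $d_\rho$ is its dimension and $\chi_\rho$ its character. For a subgroup $H\le G$, $$D_H=\frac{1}{|G|}\sum_{\rho\in \mathrm{Irr}(G)} d_\rho\Big|\sum_{h\in H,\,h\ne 1}\chi_\rho(h)\Big|.$$ $h^G$ denotes the conjugacy class of $h$ in $G$.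
   Formalization: Part 1 is proved for H ≠ {1} only: for the trivial subgroup both sides are 0, so the strict inequality fails there; part 2 is proved for every subgroup H, including H = {1}. *)

theory Defs
  imports "HOL-Algebra.Group_Action" "Jordan_Normal_Form.VS_Connect" Complex_Main
begin

definition conj_class :: "('a, 'b) monoid_scheme \<Rightarrow> 'a \<Rightarrow> 'a set" where
  "conj_class G h = orbit G (\<lambda>g x. g \<otimes>\<^bsub>G\<^esub> x \<otimes>\<^bsub>G\<^esub> inv\<^bsub>G\<^esub> g) h"

definition nonid_conj_classes :: "('a, 'b) monoid_scheme \<Rightarrow> 'a set set" where
  "nonid_conj_classes G = conj_class G ` carrier G - {{\<one>\<^bsub>G\<^esub>}}"

abbreviation GL_complex :: "nat \<Rightarrow> complex mat monoid" where
  "GL_complex n \<equiv> units_of (ring_mat TYPE(complex) n ())"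

text \<open>Values of \<open>\<rho>\<close> outside the carrier of \<open>G\<close> are unconstrained; they are also
  ignored by the equivalence \<open>irr_rep_equiv\<close> below.\<close>

definition is_rep :: "('a, 'b) monoid_scheme \<Rightarrow> nat \<Rightarrow> ('a \<Rightarrow> complex mat) \<Rightarrow> bool" where
  "is_rep G n \<rho> \<longleftrightarrow> \<rho> \<in> hom G (GL_complex n)"

definition is_irr_rep :: "('a, 'b) monoid_scheme \<Rightarrow> nat \<Rightarrow> ('a \<Rightarrow> complex mat) \<Rightarrow> bool" where
  "is_irr_rep G n \<rho> \<longleftrightarrow> is_rep G n \<rho> \<and> n > 0 \<and>
     (\<forall>W. VectorSpace.subspace class_ring W (module_vec TYPE(complex) n) \<longrightarrow>
        (\<forall>g \<in> carrier G. \<forall>w \<in> W. \<rho> g *\<^sub>v w \<in> W) \<longrightarrow>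
        W = {0\<^sub>v n} \<or> W = carrier_vec n)"

definition irr_reps :: "('a, 'b) monoid_scheme \<Rightarrow> ('a \<Rightarrow> complex mat) set" where
  "irr_reps G = {\<rho>. \<exists>n. is_irr_rep G n \<rho>}"

definition irr_rep_equiv ::
    "('a, 'b) monoid_scheme \<Rightarrow> (('a \<Rightarrow> complex mat) \<times> ('a \<Rightarrow> complex mat)) set" where
  "irr_rep_equiv G = {(\<rho>, \<sigma>). \<rho> \<in> irr_reps G \<and> \<sigma> \<in> irr_reps G \<and>
     (\<exists>P Q. \<forall>g \<in> carrier G. similar_mat_wit (\<rho> g) (\<sigma> g) P Q)}"

definition Irr :: "('a, 'b) monoid_scheme \<Rightarrow> ('a \<Rightarrow> complex mat) set set" where
  "Irr G = irr_reps G // irr_rep_equiv G"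

definition mat_trace :: "'a :: comm_monoid_add mat \<Rightarrow> 'a" where
  "mat_trace A = (\<Sum>i < dim_row A. A $$ (i, i))"

text \<open>Dimension and character of an equivalence class, via a representative; see
  \<open>irr_dim_eq\<close> and \<open>irr_char_eq\<close> for independence of the choice.\<close>

definition irr_dim :: "('a, 'b) monoid_scheme \<Rightarrow> ('a \<Rightarrow> complex mat) set \<Rightarrow> nat" where
  "irr_dim G c = (THE n. is_irr_rep G n (SOME \<rho>. \<rho> \<in> c))"

definition irr_char :: "('a \<Rightarrow> complex mat) set \<Rightarrow> 'a \<Rightarrow> complex" where
  "irr_char c g = mat_trace ((SOME \<rho>. \<rho> \<in> c) g)"

definition D_sub :: "('a, 'b) monoid_scheme \<Rightarrow> 'a set \<Rightarrow> real" where
  "D_sub G H = 1 / real (Coset.order G) *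
     (\<Sum>c \<in> Irr G. real (irr_dim G c) * cmod (\<Sum>h \<in> H - {\<one>\<^bsub>G\<^esub>}. irr_char c h))"

lemma is_rep_carrier:
  assumes "is_rep G n \<rho>" "g \<in> carrier G"
  shows "\<rho> g \<in> carrier_mat n n"
  using assms by (auto simp: is_rep_def hom_def units_of_def Units_def ring_mat_simps)

lemma is_irr_rep_carrier:
  assumes "is_irr_rep G n \<rho>" "g \<in> carrier G"
  shows "\<rho> g \<in> carrier_mat n n"
  using assms is_rep_carrier by (auto simp: is_irr_rep_def)

lemma mat_trace_comm:
  fixes A B :: "'a :: comm_semiring_0 mat"
  assumes "A \<in> carrier_mat n m" "B \<in> carrier_mat m n"
  shows "mat_trace (A * B) = mat_trace (B * A)"
proof -
  have "mat_trace (A * B) = (\<Sum>i<n. \<Sum>j<m. A $$ (i, j) * B $$ (j, i))"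
    using assms by (auto simp: mat_trace_def scalar_prod_def atLeast0LessThan intro!: sum.cong)
  also have "\<dots> = (\<Sum>j<m. \<Sum>i<n. B $$ (j, i) * A $$ (i, j))"
    by (subst sum.swap) (simp add: mult.commute)
  also have "\<dots> = mat_trace (B * A)"
    using assms by (auto simp: mat_trace_def scalar_prod_def atLeast0LessThan intro!: sum.cong)
  finally show ?thesis .
qed

lemma mat_trace_similar:
  fixes A B :: "'a :: comm_semiring_1 mat"
  assumes "similar_mat_wit A B P Q"
  shows "mat_trace A = mat_trace B"
proof -
  define n where "n = dim_row A"
  have c: "A \<in> carrier_mat n n" "B \<in> carrier_mat n n" "P \<in> carrier_mat n n" "Q \<in> carrier_mat n n"
    and e: "Q * P = 1\<^sub>m n" "A = P * B * Q"
    using similar_mat_witD[OF n_def assms] by blast+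
  have "mat_trace A = mat_trace (Q * (P * B))"
    unfolding e(2) using c by (intro mat_trace_comm[of _ n n]) auto
  also have "Q * (P * B) = B"
    using c e(1) by (simp flip: assoc_mult_mat[of Q n n P n B n])
  finally show ?thesis .
qed

lemma is_irr_rep_unique:
  assumes "group G" "is_irr_rep G n \<rho>" "is_irr_rep G m \<rho>"
  shows "n = m"
  using is_irr_rep_carrier[OF assms(2), of "\<one>\<^bsub>G\<^esub>"] is_irr_rep_carrier[OF assms(3), of "\<one>\<^bsub>G\<^esub>"]
    assms(1) by (auto simp: group.is_monoid monoid.one_closed)

lemma equiv_irr_rep_equiv: "equiv (irr_reps G) (irr_rep_equiv G)"
proof (rule equivI)
  show "irr_rep_equiv G \<subseteq> irr_reps G \<times> irr_reps G" by (auto simp: irr_rep_equiv_def)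
  show "refl_on (irr_reps G) (irr_rep_equiv G)"
  proof (rule refl_onI)
    fix \<rho> assume r: "\<rho> \<in> irr_reps G"
    then obtain n where "is_irr_rep G n \<rho>" by (auto simp: irr_reps_def)
    then have "\<forall>g \<in> carrier G. similar_mat_wit (\<rho> g) (\<rho> g) (1\<^sub>m n) (1\<^sub>m n)"
      by (auto intro!: similar_mat_wit_refl dest: is_irr_rep_carrier)
    with r show "(\<rho>, \<rho>) \<in> irr_rep_equiv G" by (auto simp: irr_rep_equiv_def)
  qed
  show "sym (irr_rep_equiv G)"
    by (rule symI) (force simp: irr_rep_equiv_def dest: similar_mat_wit_sym)
  show "trans (irr_rep_equiv G)"
  proof (rule transI)
    fix \<rho> \<sigma> \<tau> assume a: "(\<rho>, \<sigma>) \<in> irr_rep_equiv G" "(\<sigma>, \<tau>) \<in> irr_rep_equiv G"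
    then obtain P Q P' Q' where
      "\<forall>g \<in> carrier G. similar_mat_wit (\<rho> g) (\<sigma> g) P Q"
      "\<forall>g \<in> carrier G. similar_mat_wit (\<sigma> g) (\<tau> g) P' Q'"
      by (auto simp: irr_rep_equiv_def)
    then have "\<forall>g \<in> carrier G. similar_mat_wit (\<rho> g) (\<tau> g) (P * P') (Q' * Q)"
      by (blast intro: similar_mat_wit_trans)
    with a show "(\<rho>, \<tau>) \<in> irr_rep_equiv G" by (auto simp: irr_rep_equiv_def)
  qed
qed

lemma some_in_Irr:
  assumes "c \<in> Irr G" "\<rho> \<in> c"
  shows "(\<rho>, SOME \<rho>. \<rho> \<in> c) \<in> irr_rep_equiv G"
proof -
  have "(SOME \<rho>. \<rho> \<in> c) \<in> c" using assms(2) by (rule someI[of "\<lambda>\<rho>. \<rho> \<in> c"])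
  then show ?thesis
    using quotient_eq_iff[OF equiv_irr_rep_equiv, of c G c \<rho> "SOME \<rho>. \<rho> \<in> c"] assms
    by (simp add: Irr_def)
qed

lemma irr_char_eq:
  assumes "c \<in> Irr G" "\<rho> \<in> c" "g \<in> carrier G"
  shows "irr_char c g = mat_trace (\<rho> g)"
proof -
  obtain P Q where "similar_mat_wit (\<rho> g) ((SOME \<rho>. \<rho> \<in> c) g) P Q"
    using some_in_Irr[OF assms(1,2)] assms(3) by (auto simp: irr_rep_equiv_def)
  from mat_trace_similar[OF this] show ?thesis by (simp add: irr_char_def)
qed

lemma irr_dim_eq:
  assumes "group G" "c \<in> Irr G" "\<rho> \<in> c" "is_irr_rep G n \<rho>"
  shows "irr_dim G c = n"
proof -
  let ?\<sigma> = "SOME \<rho>. \<rho> \<in> c"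
  note e = some_in_Irr[OF assms(2,3)]
  have one: "\<one>\<^bsub>G\<^esub> \<in> carrier G" using assms(1) by (simp add: group.is_monoid monoid.one_closed)
  obtain m where m: "is_irr_rep G m ?\<sigma>" using e by (auto simp: irr_rep_equiv_def irr_reps_def)
  obtain P Q where "similar_mat_wit (\<rho> \<one>\<^bsub>G\<^esub>) (?\<sigma> \<one>\<^bsub>G\<^esub>) P Q"
    using e one by (auto simp: irr_rep_equiv_def)
  then have "dim_row (\<rho> \<one>\<^bsub>G\<^esub>) = dim_row (?\<sigma> \<one>\<^bsub>G\<^esub>)"
    using similar_mat_witD(5)[OF refl] by fastforce
  then have "m = n"
    using is_irr_rep_carrier[OF m one] is_irr_rep_carrier[OF assms(4) one] by simp
  with m show ?thesis
    unfolding irr_dim_def by (auto intro!: the_equality dest: is_irr_rep_unique[OF assms(1)])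
qed

end

(* For h in H, the Cauchy-Schwarz inequality applied to the vectors (d_rho) and (chi_rho(h)), whose
   squared norms are at most |G| and |G| / |h^G|, bounds h's contribution to D_H by |h^G|^(-1/2).
   For the lower bound put a_rho = sum of chi_rho over H - {1}. Then |a_rho| <= (|H| - 1) d_rho, so
   D_H >= (sum of |a_rho|^2) / (|G| (|H| - 1)), and Parseval's identity for the class function
   g |-> |g^G Int (H - {1})| / |g^G| gives
   sum of |a_rho|^2 = |G| * (sum over i of |C_i Int H|^2 / |C_i|). *)

theory Submission
  imports Defs "Jordan_Normal_Form.Schur_Decomposition" "Jordan_Normal_Form.Spectral_Radius"
    "HOL-Algebra.Multiplicative_Group"
begin

subsection \<open>Matrices and subspaces\<close>

text \<open>The two bounds need different amounts of character theory. The upper bound asks only for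
  upper estimates of sums over \<open>Irr G\<close>, which Bessel's inequality yields from
  orthogonality alone. The lower bound needs the sum of the |a_rho|^2 from below, hence
  completeness: a class function orthogonal to every irreducible character vanishes. This is the
  main work. It is proved in the regular representation, where a nonzero invariant subspace of least
  dimension is irreducible. Representations are arbitrary matrix homomorphisms, so conjugates of
  characters and the bound |chi_rho(g)| <= d_rho come from eigenvalues, which are roots of unity.
  The indicator of H - {1} is not a class function. The function in the overview is its average over
  each class; averaging keeps all inner products with characters. Strictness comes from the factor
  |H| - 1 in place of |H|, together with D_H > 0 for nontrivial H. Finiteness of
  \<open>Irr G\<close> has to precede every sum over it, because a sum over an infinite set is 0 by
  convention.\<close>

definition inj_mat :: "'a :: field mat \<Rightarrow> bool" where
  "inj_mat P \<longleftrightarrow> (\<forall>x \<in> carrier_vec (dim_col P). P *\<^sub>v x = 0\<^sub>v (dim_row P) \<longrightarrow> x = 0\<^sub>v (dim_col P))"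

lemma inj_matD:
  "inj_mat P \<Longrightarrow> P \<in> carrier_mat n k \<Longrightarrow> x \<in> carrier_vec k \<Longrightarrow> P *\<^sub>v x = 0\<^sub>v n \<Longrightarrow> x = 0\<^sub>v k"
  by (auto simp: inj_mat_def)

lemma mult_mat_vec_0 [simp]: "A \<in> carrier_mat n k \<Longrightarrow> A *\<^sub>v 0\<^sub>v k = (0\<^sub>v n :: 'a :: comm_ring_1 vec)"
  by (auto simp: scalar_prod_def)

text \<open>If \<open>n < k\<close>, padding \<open>P\<close> by zero rows gives a square matrix
  with a zero row. It is singular, and a nonzero vector in its kernel lies in the kernel of
  \<open>P\<close> too.\<close>

lemma inj_mat_dims:
  assumes "inj_mat (P :: 'a :: field mat)" "P \<in> carrier_mat n k"
  shows "k \<le> n"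
proof (rule ccontr)
  assume "\<not> k \<le> n"
  then have nk: "n < k" by simp
  define A where "A = mat k k (\<lambda>(i,j). if i < n then P $$ (i,j) else 0)"
  have A: "A \<in> carrier_mat k k" by (simp add: A_def)
  have "A\<^sup>T *\<^sub>v unit_vec k n = 0\<^sub>v k"
    using nk by (intro eq_vecI) (auto simp: A_def)
  then have "det (A\<^sup>T) = 0"
    using det_0_iff_vec_prod_zero_field[of "A\<^sup>T" k] A nk unit_vec_nonzero[of n k] unit_vec_carrier[of k n] by (metis transpose_carrier_mat)
  then have "det A = 0" using A det_transpose by metis
  then obtain v where v: "v \<in> carrier_vec k" "v \<noteq> 0\<^sub>v k" "A *\<^sub>v v = 0\<^sub>v k"
    using det_0_iff_vec_prod_zero_field[OF A] by auto
  have "P *\<^sub>v v = 0\<^sub>v n"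
  proof (rule eq_vecI)
    fix i assume "i < dim_vec (0\<^sub>v n :: 'a vec)"
    then have i: "i < n" by simp
    have "(P *\<^sub>v v) $ i = (A *\<^sub>v v) $ i"
      using assms(2) i nk v(1) by (auto simp: A_def scalar_prod_def intro!: sum.cong)
    then show "(P *\<^sub>v v) $ i = 0\<^sub>v n $ i" using v(3) i nk by simp
  qed (use assms in auto)
  with inj_matD[OF assms v(1)] v(2) show False by simp
qed

lemma inj_mat_square:
  assumes "inj_mat (P :: 'a :: field mat)" "P \<in> carrier_mat n n"
  obtains Q where "Q \<in> carrier_mat n n" "P * Q = 1\<^sub>m n" "Q * P = 1\<^sub>m n"
proof -
  have "det P \<noteq> 0"
    using det_0_iff_vec_prod_zero_field[OF assms(2)] inj_matD[OF assms] by auto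
  from det_non_zero_imp_unit[OF assms(2) this, of undefined] that show thesis
    by (auto simp: Units_def ring_mat_simps)
qed

lemma mult_mat_unit_vec: "A \<in> carrier_mat n k \<Longrightarrow> j < k \<Longrightarrow> A *\<^sub>v unit_vec k j = (col A j :: 'a :: comm_ring_1 vec)"
  by (intro eq_vecI) auto

text \<open>Lets an identity between the matrices of a subrepresentation be verified after
  multiplication by the matrix of its basis.\<close>

lemma inj_mat_cancel:
  assumes "inj_mat (P :: 'a :: field mat)" "P \<in> carrier_mat n k"
    "A \<in> carrier_mat k m" "B \<in> carrier_mat k m" "P * A = P * B"
  shows "A = B"
proof -
  have "col A j = col B j" if j: "j < m" for j
  proof -
    have c: "col A j \<in> carrier_vec k" "col B j \<in> carrier_vec k" using assms by auto
    have "P *\<^sub>v col A j = P *\<^sub>v col B j"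
      using assms(5) col_mult2[OF assms(2,3) j] col_mult2[OF assms(2,4) j] by simp
    then have "P *\<^sub>v (col A j - col B j) = 0\<^sub>v n"
      using assms(2) c by (subst mult_minus_distrib_mat_vec[of _ n k]) auto
    then have z: "col A j - col B j = 0\<^sub>v k"
      using inj_matD[OF assms(1,2)] c by auto
    show ?thesis
    proof (rule eq_vecI)
      fix i assume "i < dim_vec (col B j)"
      then have i: "i < k" using assms by simp
      have "(col A j - col B j) $ i = 0" using z i by simp
      moreover have "(col A j - col B j) $ i = col A j $ i - col B j $ i"
        using c(2) i unfolding carrier_vec_def by (intro index_minus_vec) simp
      ultimately show "col A j $ i = col B j $ i" by simp
    qed (use assms in auto)
  qed
  then show ?thesis by (intro mat_col_eqI) (use assms in auto)
qed

abbreviation vec_subspace :: "nat \<Rightarrow> 'a :: field vec set \<Rightarrow> bool" where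
  "vec_subspace n W \<equiv> VectorSpace.subspace class_ring W (module_vec TYPE('a) n)"

lemma vec_subspace_iff:
  "vec_subspace n W \<longleftrightarrow> W \<subseteq> carrier_vec n \<and> 0\<^sub>v n \<in> W \<and>
    (\<forall>v \<in> W. \<forall>w \<in> W. v + w \<in> W) \<and> (\<forall>c. \<forall>v \<in> W. c \<cdot>\<^sub>v v \<in> W)"
proof -
  interpret vec_space "TYPE('a)" n .
  have "vec_subspace n W \<longleftrightarrow> submodule class_ring W V"
    unfolding VectorSpace.subspace_def using vectorspace_axioms by simp
  also have "\<dots> \<longleftrightarrow> W \<subseteq> carrier_vec n \<and> 0\<^sub>v n \<in> W \<and>
    (\<forall>v \<in> W. \<forall>w \<in> W. v + w \<in> W) \<and> (\<forall>c. \<forall>v \<in> W. c \<cdot>\<^sub>v v \<in> W)"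
    unfolding submodule_def using module_axioms by (auto simp: module_vec_simps)
  finally show ?thesis .
qed

definition mat_range :: "'a :: comm_ring_1 mat \<Rightarrow> 'a vec set" where
  "mat_range P = (\<lambda>x. P *\<^sub>v x) ` carrier_vec (dim_col P)"

lemma mat_range_carrier: "P \<in> carrier_mat n k \<Longrightarrow> mat_range P = (\<lambda>x. P *\<^sub>v x) ` carrier_vec k"
  by (auto simp: mat_range_def)

lemma vec_subspace_mat_range:
  assumes "P \<in> carrier_mat n k"
  shows "vec_subspace n (mat_range P)"
  unfolding vec_subspace_iff mat_range_carrier[OF assms]
proof (intro conjI ballI allI)
  show "0\<^sub>v n \<in> (*\<^sub>v) P ` carrier_vec k" using assms by (intro image_eqI[of _ _ "0\<^sub>v k"]) auto
next
  fix v w assume "v \<in> (*\<^sub>v) P ` carrier_vec k" "w \<in> (*\<^sub>v) P ` carrier_vec k"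
  then obtain x y where xy: "x \<in> carrier_vec k" "y \<in> carrier_vec k" "v = P *\<^sub>v x" "w = P *\<^sub>v y" by auto
  then show "v + w \<in> (*\<^sub>v) P ` carrier_vec k"
    using assms by (intro image_eqI[of _ _ "x + y"]) (auto simp: mult_add_distrib_mat_vec)
next
  fix c v assume "v \<in> (*\<^sub>v) P ` carrier_vec k"
  then obtain x where x: "x \<in> carrier_vec k" "v = P *\<^sub>v x" by auto
  then show "c \<cdot>\<^sub>v v \<in> (*\<^sub>v) P ` carrier_vec k"
    using assms by (intro image_eqI[of _ _ "c \<cdot>\<^sub>v x"]) (auto simp: mult_mat_vec)
qed (use assms in auto)

lemma vec_subspace_kernel:
  assumes "P \<in> carrier_mat n k"
  shows "vec_subspace k {x \<in> carrier_vec k. P *\<^sub>v x = 0\<^sub>v n}"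
  unfolding vec_subspace_iff using assms
  by (auto simp: mult_add_distrib_mat_vec[OF assms] mult_mat_vec[OF assms])

lemma mat_range_append:
  assumes "P \<in> carrier_mat n k" "w \<in> carrier_vec n" "x \<in> carrier_vec k"
  shows "mat n (Suc k) (\<lambda>(i,j). if j < k then P $$ (i,j) else w $ i) *\<^sub>v vec (Suc k) (\<lambda>j. if j < k then x $ j else c)
     = P *\<^sub>v x + c \<cdot>\<^sub>v (w :: 'a :: comm_ring_1 vec)"
  using assms by (intro eq_vecI) (auto simp: scalar_prod_def)

text \<open>Choose \<open>k\<close> largest such that \<open>W\<close> contains the range of an
  injective matrix with \<open>k\<close> columns; the number of rows bounds \<open>k\<close>. A
  vector of \<open>W\<close> outside the range could be appended as a further column. The columns of
  \<open>P\<close> then form a basis of \<open>W\<close>.\<close>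

lemma vec_subspace_basis:
  assumes W: "vec_subspace n (W :: 'a :: field vec set)"
  obtains k P where "P \<in> carrier_mat n k" "inj_mat P" "mat_range P = W"
proof -
  define S where "S k \<longleftrightarrow> (\<exists>P \<in> carrier_mat n k. inj_mat P \<and> mat_range P \<subseteq> W)" for k
  have W': "W \<subseteq> carrier_vec n" "0\<^sub>v n \<in> W" "\<And>v w. v \<in> W \<Longrightarrow> w \<in> W \<Longrightarrow> v + w \<in> W"
    "\<And>c v. v \<in> W \<Longrightarrow> c \<cdot>\<^sub>v v \<in> W"
    using W by (auto simp: vec_subspace_iff)
  have "S 0" unfolding S_def
  proof (intro bexI[of _ "0\<^sub>m n 0"] conjI)
    show "inj_mat (0\<^sub>m n 0 :: 'a mat)" by (auto simp: inj_mat_def)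
    have "0\<^sub>m n 0 *\<^sub>v x = 0\<^sub>v n" if "x \<in> carrier_vec 0" for x :: "'a vec"
      using that by (intro eq_vecI) (auto simp: scalar_prod_def)
    then show "mat_range (0\<^sub>m n 0) \<subseteq> W" using W'(2) by (auto simp: mat_range_def)
  qed auto
  moreover have bd: "k \<le> n" if "S k" for k using that inj_mat_dims by (auto simp: S_def)
  ultimately have m: "S (Greatest S)" "\<And>k. S k \<Longrightarrow> k \<le> Greatest S"
    by (blast intro: GreatestI_nat Greatest_le_nat)+
  define k where "k = Greatest S"
  obtain P where P: "P \<in> carrier_mat n k" "inj_mat P" "mat_range P \<subseteq> W"
    using m(1) by (auto simp: S_def k_def)
  have "W \<subseteq> mat_range P"
  proof (rule ccontr)
    assume "\<not> W \<subseteq> mat_range P"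
    then obtain w where w: "w \<in> W" "w \<notin> mat_range P" by auto
    have wc: "w \<in> carrier_vec n" using w W' by auto
    define P' where "P' = mat n (Suc k) (\<lambda>(i,j). if j < k then P $$ (i,j) else w $ i)"
    have P': "P' \<in> carrier_mat n (Suc k)" by (simp add: P'_def)
    have ap: "P' *\<^sub>v y = P *\<^sub>v vec k (($) y) + y $ k \<cdot>\<^sub>v w" if "y \<in> carrier_vec (Suc k)" for y
    proof -
      have "y = vec (Suc k) (\<lambda>j. if j < k then vec k (($) y) $ j else y $ k)"
        using that by (intro eq_vecI) (auto simp: less_Suc_eq)
      then show ?thesis unfolding P'_def
        using mat_range_append[OF P(1) wc, of "vec k (($) y)" "y $ k"] by simp
    qed
    have Pw: "P *\<^sub>v x \<in> W" if "x \<in> carrier_vec k" for x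
      using P(3) that by (auto simp: mat_range_carrier[OF P(1)])
    have r: "mat_range P' \<subseteq> W"
      unfolding mat_range_carrier[OF P'] using ap Pw W' w(1) by auto
    have "inj_mat P'"
      unfolding inj_mat_def
    proof (intro ballI impI)
      fix y assume "y \<in> carrier_vec (dim_col P')" "P' *\<^sub>v y = 0\<^sub>v (dim_row P')"
      then have y: "y \<in> carrier_vec (Suc k)" and e: "P *\<^sub>v vec k (($) y) + y $ k \<cdot>\<^sub>v w = 0\<^sub>v n"
        using P' ap by auto
      have yk: "y $ k = 0"
      proof (rule ccontr)
        \<comment> \<open>Otherwise the linear relation can be solved for \<open>w\<close>, which
          puts \<open>w\<close> into the range of \<open>P\<close>.\<close>
        assume nz: "y $ k \<noteq> 0"
        have "P *\<^sub>v (- inverse (y $ k) \<cdot>\<^sub>v vec k (($) y)) = w"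
        proof (subst mult_mat_vec[OF P(1)])
          show "- inverse (y $ k) \<cdot>\<^sub>v (P *\<^sub>v vec k (($) y)) = w"
          proof (rule eq_vecI)
            fix i assume "i < dim_vec w"
            then have i: "i < n" using wc by simp
            have "(P *\<^sub>v vec k (($) y) + y $ k \<cdot>\<^sub>v w) $ i = 0" using e i by simp
            then have "(P *\<^sub>v vec k (($) y)) $ i + y $ k * w $ i = 0" using i wc P by simp
            then show "(- inverse (y $ k) \<cdot>\<^sub>v (P *\<^sub>v vec k (($) y))) $ i = w $ i"
              using nz i P by (simp add: field_simps eq_neg_iff_add_eq_0)
                (metis add.commute add_eq_0_iff)
          qed (use P wc in auto)
        qed auto
        moreover have "- inverse (y $ k) \<cdot>\<^sub>v vec k (($) y) \<in> carrier_vec k" by simp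
        ultimately show False using w(2) unfolding mat_range_carrier[OF P(1)] by blast
      qed
      have "P *\<^sub>v vec k (($) y) = 0\<^sub>v n"
      proof -
        have "y $ k \<cdot>\<^sub>v w = 0\<^sub>v n" using wc yk by (intro eq_vecI) auto
        then show ?thesis using e P by simp
      qed
      then have "vec k (($) y) = 0\<^sub>v k" using inj_matD[OF P(2,1)] by simp
      then have "y $ j = 0" if "j < k" for j using that by (metis index_vec index_zero_vec(1))
      then show "y = 0\<^sub>v (dim_col P')" using y yk P' by (intro eq_vecI) (auto simp: less_Suc_eq)
    qed
    then have "S (Suc k)" using r P' by (auto simp: S_def)
    then show False using m(2)[of "Suc k"] by (simp add: k_def)
  qed
  with P that show thesis by auto
qed

text \<open>Column \<open>j\<close> of \<open>T\<close> holds coordinates of column \<open>j\<close>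
  of \<open>A\<close> with respect to the columns of \<open>P\<close>. On an invariant range this
  gives the matrix of the restricted action; for \<open>A\<close> the identity it gives a right
  inverse.\<close>

lemma mat_factor:
  assumes P: "P \<in> carrier_mat n k" and A: "A \<in> carrier_mat n m"
    and r: "\<And>j. j < m \<Longrightarrow> col A j \<in> mat_range P"
  obtains T where "T \<in> carrier_mat k m" "A = P * T"
proof -
  have "\<exists>x. j < m \<longrightarrow> x \<in> carrier_vec k \<and> P *\<^sub>v x = col A j" for j
    using r[of j] unfolding mat_range_carrier[OF P] by (auto simp: image_iff) metis
  then obtain s where s: "\<And>j. j < m \<Longrightarrow> s j \<in> carrier_vec k \<and> P *\<^sub>v s j = col A j" by metis
  define T where "T = mat k m (\<lambda>(i,j). s j $ i)"
  have T: "T \<in> carrier_mat k m" by (simp add: T_def)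
  have cT: "col T j = s j" if "j < m" for j
    using that s[OF that] by (intro eq_vecI) (auto simp: T_def)
  have "P * T = A"
  proof (rule mat_col_eqI)
    fix j assume "j < dim_col A"
    then have j: "j < m" using A by simp
    show "col (P * T) j = col A j" using s[OF j] j by (simp only: col_mult2[OF P T j] cT)
  qed (use P T A in auto)
  with T that show thesis by blast
qed

lemma mat_range_full_if_square:
  assumes "inj_mat (P :: 'a :: field mat)" "P \<in> carrier_mat n n"
  shows "mat_range P = carrier_vec n"
proof -
  obtain Q where Q: "Q \<in> carrier_mat n n" "P * Q = 1\<^sub>m n" using inj_mat_square[OF assms] by auto
  have "x \<in> mat_range P" if x: "x \<in> carrier_vec n" for x
  proof -
    have "x = P *\<^sub>v (Q *\<^sub>v x)"
      using Q x assms(2) by (simp flip: assoc_mult_mat_vec)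
    then show ?thesis unfolding mat_range_carrier[OF assms(2)] using Q x by auto
  qed
  then show ?thesis using assms(2) by (auto simp: mat_range_carrier[OF assms(2)])
qed

lemma inj_mat_mult:
  assumes P: "P \<in> carrier_mat n m" "inj_mat P" and B: "B \<in> carrier_mat m k" "inj_mat B"
  shows "inj_mat (P * B)"
  unfolding inj_mat_def
proof (intro ballI impI)
  fix x assume "x \<in> carrier_vec (dim_col (P * B))" "(P * B) *\<^sub>v x = 0\<^sub>v (dim_row (P * B))"
  then have x: "x \<in> carrier_vec k" "P *\<^sub>v (B *\<^sub>v x) = 0\<^sub>v n" using P B by auto
  then have "B *\<^sub>v x = 0\<^sub>v m" using inj_matD[OF P(2,1)] B by auto
  then show "x = 0\<^sub>v (dim_col (P * B))" using inj_matD[OF B(2,1) x(1)] B by simp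
qed

lemma mat_range_mult:
  assumes P: "P \<in> carrier_mat n m" and B: "B \<in> carrier_mat m k"
  shows "mat_range (P * B) = (\<lambda>x. P *\<^sub>v x) ` mat_range B"
  unfolding mat_range_carrier[OF mult_carrier_mat[OF P B]] mat_range_carrier[OF B] image_image
  using P B by (intro image_cong) auto

section \<open>Sums of matrices over a finite index set\<close>

text \<open>Matrices of all sizes share one type and have no common zero, so the shape of the sum is
  passed explicitly.\<close>

definition mat_sum :: "nat \<Rightarrow> nat \<Rightarrow> ('b \<Rightarrow> 'a :: comm_ring_1 mat) \<Rightarrow> 'b set \<Rightarrow> 'a mat" where
  "mat_sum n m f A = mat n m (\<lambda>(i,j). \<Sum>g\<in>A. f g $$ (i,j))"

lemma mat_sum_carrier [simp]: "mat_sum n m f A \<in> carrier_mat n m"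
  by (simp add: mat_sum_def)

lemma mat_sum_index: "i < n \<Longrightarrow> j < m \<Longrightarrow> mat_sum n m f A $$ (i,j) = (\<Sum>g\<in>A. f g $$ (i,j))"
  by (simp add: mat_sum_def)

lemma mult_mat_sum:
  assumes "B \<in> carrier_mat p n" "\<And>g. g \<in> A \<Longrightarrow> f g \<in> carrier_mat n m"
  shows "B * mat_sum n m f A = mat_sum p m (\<lambda>g. B * f g) A"
proof (rule eq_matI)
  fix i j assume "i < dim_row (mat_sum p m (\<lambda>g. B * f g) A)" "j < dim_col (mat_sum p m (\<lambda>g. B * f g) A)"
  then have ij: "i < p" "j < m" by (auto simp: mat_sum_def)
  have "(B * mat_sum n m f A) $$ (i,j) = (\<Sum>l<n. B $$ (i,l) * (\<Sum>g\<in>A. f g $$ (l,j)))"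
    using assms(1) ij by (auto simp: mat_sum_def scalar_prod_def atLeast0LessThan intro!: sum.cong)
  also have "\<dots> = (\<Sum>g\<in>A. \<Sum>l<n. B $$ (i,l) * f g $$ (l,j))"
    unfolding sum_distrib_left by (rule sum.swap)
  also have "\<dots> = (\<Sum>g\<in>A. (B * f g) $$ (i,j))"
    by (intro sum.cong refl, subst index_mult_mat)
      (use assms ij in \<open>auto simp: scalar_prod_def atLeast0LessThan dest!: assms(2) intro!: sum.cong\<close>)
  finally show "(B * mat_sum n m f A) $$ (i,j) = mat_sum p m (\<lambda>g. B * f g) A $$ (i,j)"
    using ij by (simp add: mat_sum_index)
qed (use assms in \<open>auto simp: mat_sum_def\<close>)

lemma mat_sum_mult:
  assumes "B \<in> carrier_mat m p" "\<And>g. g \<in> A \<Longrightarrow> f g \<in> carrier_mat n m"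
  shows "mat_sum n m f A * B = mat_sum n p (\<lambda>g. f g * B) A"
proof (rule eq_matI)
  fix i j assume "i < dim_row (mat_sum n p (\<lambda>g. f g * B) A)" "j < dim_col (mat_sum n p (\<lambda>g. f g * B) A)"
  then have ij: "i < n" "j < p" by (auto simp: mat_sum_def)
  have "(mat_sum n m f A * B) $$ (i,j) = (\<Sum>l<m. (\<Sum>g\<in>A. f g $$ (i,l)) * B $$ (l,j))"
    using assms(1) ij by (auto simp: mat_sum_def scalar_prod_def atLeast0LessThan intro!: sum.cong)
  also have "\<dots> = (\<Sum>g\<in>A. \<Sum>l<m. f g $$ (i,l) * B $$ (l,j))"
    unfolding sum_distrib_right by (rule sum.swap)
  also have "\<dots> = (\<Sum>g\<in>A. (f g * B) $$ (i,j))"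
    by (intro sum.cong refl, subst index_mult_mat)
      (use assms ij in \<open>auto simp: scalar_prod_def atLeast0LessThan dest!: assms(2) intro!: sum.cong\<close>)
  finally show "(mat_sum n m f A * B) $$ (i,j) = mat_sum n p (\<lambda>g. f g * B) A $$ (i,j)"
    using ij by (simp add: mat_sum_index)
qed (use assms in \<open>auto simp: mat_sum_def\<close>)

lemma mat_sum_cong: "(\<And>g. g \<in> A \<Longrightarrow> f g = h g) \<Longrightarrow> mat_sum n m f A = mat_sum n m h A"
  by (auto simp: mat_sum_def intro!: cong_mat sum.cong)

lemma mat_sum_reindex:
  "bij_betw \<pi> A A' \<Longrightarrow> mat_sum n m f A' = mat_sum n m (\<lambda>g. f (\<pi> g)) A"
  by (auto simp: mat_sum_def intro!: cong_mat sum.reindex_bij_betw[symmetric])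

lemma mat_trace_mat_sum:
  assumes "\<And>g. g \<in> A \<Longrightarrow> f g \<in> carrier_mat n n"
  shows "mat_trace (mat_sum n n f A) = (\<Sum>g\<in>A. mat_trace (f g))"
proof -
  have "mat_trace (mat_sum n n f A) = (\<Sum>i<n. \<Sum>g\<in>A. f g $$ (i,i))"
    by (simp add: mat_trace_def mat_sum_def)
  also have "\<dots> = (\<Sum>g\<in>A. \<Sum>i<n. f g $$ (i,i))" by (rule sum.swap)
  also have "\<dots> = (\<Sum>g\<in>A. mat_trace (f g))"
    using assms by (auto simp: mat_trace_def intro!: sum.cong)
  finally show ?thesis .
qed

section \<open>Traces of complex matrices of finite order\<close>

text \<open>In the entry (i,j) of the product only the terms with i <= l <= j survive. On or below
  the diagonal this leaves at most l = i = j.\<close>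

lemma upper_triangular_mult:
  assumes "A \<in> carrier_mat n n" "B \<in> carrier_mat n n" "upper_triangular A" "upper_triangular B"
  shows "upper_triangular (A * B)" "i < n \<Longrightarrow> (A * B) $$ (i,i) = A $$ (i,i) * (B $$ (i,i) :: 'a :: comm_ring_1)"
proof -
  have e: "(A * B) $$ (i,j) = (\<Sum>l<n. if l = i \<and> i = j then A $$ (i,i) * B $$ (i,i) else 0)"
    if ij: "i < n" "j \<le> i" for i j
  proof -
    have "(A * B) $$ (i,j) = (\<Sum>l<n. A $$ (i,l) * B $$ (l,j))"
      using assms ij by (auto simp: scalar_prod_def atLeast0LessThan intro!: sum.cong)
    also have "\<dots> = (\<Sum>l<n. if l = i \<and> i = j then A $$ (i,i) * B $$ (i,i) else 0)"
    proof (rule sum.cong[OF refl])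
      fix l assume "l \<in> {..<n}"
      moreover have "A $$ (i,l) = 0" if "l < i" using assms ij that by auto
      moreover have "B $$ (l,j) = 0" if "j < l" "l < n" using assms ij that by auto
      ultimately show "A $$ (i,l) * B $$ (l,j) = (if l = i \<and> i = j then A $$ (i,i) * B $$ (i,i) else 0)"
        using ij by (cases "l < i"; cases "j < l"; cases "l = i \<and> i = j") auto
    qed
    finally show ?thesis .
  qed
  show "upper_triangular (A * B)"
    using assms e by (auto intro!: upper_triangularI)
  show "i < n \<Longrightarrow> (A * B) $$ (i,i) = A $$ (i,i) * B $$ (i,i)"
    using e[of i i] by simp
qed

lemma upper_triangular_pow:
  assumes "(A :: 'a :: comm_ring_1 mat) \<in> carrier_mat n n" "upper_triangular A"
  shows "upper_triangular (A ^\<^sub>m k) \<and> (\<forall>i<n. (A ^\<^sub>m k) $$ (i,i) = (A $$ (i,i)) ^ k)"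
proof (induction k)
  case 0
  show ?case using assms(1) by (auto intro!: upper_triangularI)
next
  case (Suc k)
  then show ?case
    using upper_triangular_mult[of "A ^\<^sub>m k" n A] assms by (auto simp: power_commutes)
qed

text \<open>Triangularization gives the inverse-conjugate relation for traces without unitarizing the
  representation.\<close>

lemma trace_root_of_one:
  fixes A :: "complex mat"
  assumes A: "A \<in> carrier_mat n n" and N: "A ^\<^sub>m N = 1\<^sub>m n" "N > 0"
  shows "cmod (mat_trace A) \<le> real n" "mat_trace (A ^\<^sub>m (N - 1)) = cnj (mat_trace A)"
proof -
  obtain as where "char_poly A = (\<Prod>a\<leftarrow>as. [:- a, 1:])" using char_poly_factorized[OF A] by blast
  from schur_decomposition_exists[OF A this]
  obtain B P Q where B: "B \<in> carrier_mat n n" "upper_triangular B" and w: "similar_mat_wit A B P Q"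
    unfolding similar_mat_def by blast
  note wk = similar_mat_wit_pow[OF w]
  have PQ: "P \<in> carrier_mat n n" "Q \<in> carrier_mat n n" "Q * P = 1\<^sub>m n"
    using similar_mat_witD2[OF A w] by auto
  have "similar_mat_wit (B ^\<^sub>m N) (1\<^sub>m n) Q P"
    using similar_mat_wit_sym[OF wk[of N]] N by simp
  then have "B ^\<^sub>m N = Q * 1\<^sub>m n * P"
    unfolding similar_mat_wit_def Let_def by auto
  then have BN: "B ^\<^sub>m N = 1\<^sub>m n" using PQ by simp
  let ?b = "\<lambda>i. B $$ (i,i)"
  have pw: "(B ^\<^sub>m k) $$ (i,i) = ?b i ^ k" if "i < n" for i k
    using upper_triangular_pow[OF B] that by blast
  \<comment> \<open>The diagonal of the triangular form lists the eigenvalues, which are therefore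
    \<open>N\<close>-th roots of unity.\<close>
  have root: "?b i ^ N = 1" if "i < n" for i using pw[OF that, of N] BN that by simp
  then have mod1: "cmod (?b i) = 1" if "i < n" for i
    using that N(2) by (metis norm_power norm_one power_eq_1_iff norm_ge_zero less_not_refl)
  have trA: "mat_trace A = (\<Sum>i<n. ?b i)"
    using mat_trace_similar[OF w] B by (simp add: mat_trace_def)
  show "cmod (mat_trace A) \<le> real n"
    unfolding trA using sum_norm_le[of "{..<n}" ?b "\<lambda>_. 1"] mod1 by simp
  \<comment> \<open>The exponent \<open>N - 1\<close> inverts an \<open>N\<close>-th root of unity,
    and on the unit circle the inverse is the conjugate.\<close>
  have "?b i ^ (N - 1) = cnj (?b i)" if i: "i < n" for i
  proof -
    have "?b i * ?b i ^ (N - 1) = 1" using root[OF i] N(2) by (cases N) auto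
    moreover have "?b i * cnj (?b i) = 1" using mod1[OF i] complex_norm_square[of "?b i"] by simp
    ultimately show ?thesis by (metis mult_cancel_left mult_zero_left zero_neq_one)
  qed
  then show "mat_trace (A ^\<^sub>m (N - 1)) = cnj (mat_trace A)"
    unfolding mat_trace_similar[OF wk] trA using B pw by (simp add: mat_trace_def)
qed

text \<open>The matrix unit with its 1 in row \<open>j\<close> and column \<open>k\<close>. Between
  two matrices it isolates a product of one entry from each, which later turns products of traces
  into entries of averaged intertwiners.\<close>

definition elem_mat :: "nat \<Rightarrow> nat \<Rightarrow> nat \<Rightarrow> nat \<Rightarrow> 'a :: comm_ring_1 mat" where
  "elem_mat n m j k = mat n m (\<lambda>(p,q). if p = j \<and> q = k then 1 else 0)"

lemma elem_mat_carrier [simp]: "elem_mat n m j k \<in> carrier_mat n m"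
  by (simp add: elem_mat_def)

lemma mult_elem_mat_mult:
  assumes A: "A \<in> carrier_mat n n" and B: "B \<in> carrier_mat m m"
    and ij: "i < n" "j < n" "k < m" "l < m"
  shows "(A * elem_mat n m j k * B) $$ (i,l) = A $$ (i,j) * (B $$ (k,l) :: 'a :: comm_ring_1)"
proof -
  have AE: "(A * elem_mat n m j k) $$ (i,q) = (if q = k then A $$ (i,j) else 0)" if "q < m" for q
  proof -
    have "(A * elem_mat n m j k) $$ (i,q) = (\<Sum>p<n. A $$ (i,p) * (if p = j \<and> q = k then 1 else 0))"
      using A ij that by (auto simp: elem_mat_def scalar_prod_def atLeast0LessThan intro!: sum.cong)
    also have "\<dots> = (\<Sum>p<n. if p = j then (if q = k then A $$ (i,j) else 0) else 0)"
      by (intro sum.cong) auto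
    finally show ?thesis using ij by simp
  qed
  have "(A * elem_mat n m j k * B) $$ (i,l) = (\<Sum>q<m. (A * elem_mat n m j k) $$ (i,q) * B $$ (q,l))"
    using A B ij by (subst index_mult_mat) (auto simp: scalar_prod_def atLeast0LessThan elem_mat_def intro!: sum.cong)
  also have "\<dots> = (\<Sum>q<m. if q = k then A $$ (i,j) * B $$ (k,l) else 0)"
    by (intro sum.cong refl, subst AE) auto
  finally show ?thesis using ij by simp
qed

subsection \<open>Bessel's inequality for finite sums\<close>

context
  fixes X :: "'x set" and S :: "'c set" and \<chi> :: "'c \<Rightarrow> 'x \<Rightarrow> complex" and N :: real
    and \<phi> :: "'x \<Rightarrow> complex" and a :: "'c \<Rightarrow> complex" and \<psi> :: "'x \<Rightarrow> complex"
  assumes fin: "finite S" and N: "N > 0"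
    and orth: "\<And>c d. c \<in> S \<Longrightarrow> d \<in> S \<Longrightarrow>
      (\<Sum>x\<in>X. \<chi> c x * cnj (\<chi> d x)) = (if c = d then of_real N else 0)"
  defines "a \<equiv> \<lambda>c. \<Sum>x\<in>X. \<phi> x * cnj (\<chi> c x)"
    and "\<psi> \<equiv> \<lambda>x. \<phi> x - (\<Sum>c\<in>S. a c / of_real N * \<chi> c x)"
begin

text \<open>Each \<open>\<chi> c\<close> has squared norm \<open>N\<close>, so the sum subtracted in
  \<open>\<psi>\<close> is the orthogonal projection of \<open>\<phi>\<close> onto their span, and
  \<open>\<psi>\<close> is the residual.\<close>

lemma residual_orthogonal:
  assumes d: "d \<in> S"
  shows "(\<Sum>x\<in>X. \<psi> x * cnj (\<chi> d x)) = 0"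
proof -
  have "(\<Sum>x\<in>X. \<psi> x * cnj (\<chi> d x)) = a d - (\<Sum>x\<in>X. \<Sum>c\<in>S. a c / of_real N * (\<chi> c x * cnj (\<chi> d x)))"
    unfolding \<psi>_def a_def
    by (simp add: left_diff_distrib sum_subtractf sum_distrib_right mult.assoc)
  also have "(\<Sum>x\<in>X. \<Sum>c\<in>S. a c / of_real N * (\<chi> c x * cnj (\<chi> d x))) =
      (\<Sum>c\<in>S. a c / of_real N * (\<Sum>x\<in>X. \<chi> c x * cnj (\<chi> d x)))"
    by (subst sum.swap) (simp add: sum_distrib_left)
  also have "\<dots> = (\<Sum>c\<in>S. if c = d then a d else 0)"
    using orth d N by (intro sum.cong) auto
  also have "\<dots> = a d" using d fin by simp
  finally show ?thesis by simp
qed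

text \<open>Pythagoras for the projection. The exact form serves twice: nonnegativity of the left
  side is Bessel's inequality, and its vanishing is Parseval's identity.\<close>

lemma residual_norm:
  "(\<Sum>x\<in>X. (cmod (\<psi> x))\<^sup>2) = (\<Sum>x\<in>X. (cmod (\<phi> x))\<^sup>2) - (\<Sum>c\<in>S. (cmod (a c))\<^sup>2) / N"
proof -
  \<comment> \<open>Only the conjugated factor is expanded, so that its projection part is paired
    with the residual and vanishes.\<close>
  have "(\<Sum>x\<in>X. \<psi> x * cnj (\<psi> x)) = (\<Sum>x\<in>X. \<psi> x * cnj (\<phi> x)) -
      (\<Sum>x\<in>X. \<Sum>c\<in>S. cnj (a c) / of_real N * (\<psi> x * cnj (\<chi> c x)))"
    by (subst (2) \<psi>_def) (simp add: right_diff_distrib sum_subtractf sum_distrib_left mult_ac)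
  also have "(\<Sum>x\<in>X. \<Sum>c\<in>S. cnj (a c) / of_real N * (\<psi> x * cnj (\<chi> c x))) =
      (\<Sum>c\<in>S. cnj (a c) / of_real N * (\<Sum>x\<in>X. \<psi> x * cnj (\<chi> c x)))"
    by (subst sum.swap) (simp add: sum_distrib_left)
  also have "\<dots> = 0" by (simp add: residual_orthogonal)
  also have "(\<Sum>x\<in>X. \<psi> x * cnj (\<phi> x)) = (\<Sum>x\<in>X. \<phi> x * cnj (\<phi> x)) -
      (\<Sum>x\<in>X. \<Sum>c\<in>S. a c / of_real N * cnj (\<phi> x * cnj (\<chi> c x)))"
    unfolding \<psi>_def
    by (simp add: left_diff_distrib right_diff_distrib sum_subtractf sum_distrib_right sum_distrib_left mult_ac)
  also have "(\<Sum>x\<in>X. \<Sum>c\<in>S. a c / of_real N * cnj (\<phi> x * cnj (\<chi> c x))) =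
      (\<Sum>c\<in>S. a c / of_real N * cnj (a c))"
    unfolding a_def cnj_sum by (subst sum.swap) (simp add: sum_distrib_left)
  finally have "(\<Sum>x\<in>X. \<psi> x * cnj (\<psi> x)) =
    (\<Sum>x\<in>X. \<phi> x * cnj (\<phi> x)) - (\<Sum>c\<in>S. a c * cnj (a c)) / of_real N"
    by (simp add: sum_divide_distrib)
  then have "complex_of_real (\<Sum>x\<in>X. (cmod (\<psi> x))\<^sup>2) =
    of_real ((\<Sum>x\<in>X. (cmod (\<phi> x))\<^sup>2) - (\<Sum>c\<in>S. (cmod (a c))\<^sup>2) / N)"
    by (simp add: complex_norm_square del: of_real_power)
  then show ?thesis by (simp only: of_real_eq_iff)
qed

lemma bessel: "(\<Sum>c\<in>S. (cmod (\<Sum>x\<in>X. \<phi> x * cnj (\<chi> c x)))\<^sup>2) \<le> N * (\<Sum>x\<in>X. (cmod (\<phi> x))\<^sup>2)"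
proof -
  have "0 \<le> (\<Sum>x\<in>X. (cmod (\<psi> x))\<^sup>2)" by (simp add: sum_nonneg)
  then show ?thesis using N unfolding residual_norm a_def by (simp add: field_simps)
qed

end

subsection \<open>Matrix representations and Schur's lemma\<close>

lemma is_irr_rep_rep: "is_irr_rep G n \<rho> \<Longrightarrow> is_rep G n \<rho>"
  by (simp add: is_irr_rep_def)

context group
begin

lemma is_rep_mult:
  "is_rep G n \<rho> \<Longrightarrow> g \<in> carrier G \<Longrightarrow> h \<in> carrier G \<Longrightarrow> \<rho> (g \<otimes> h) = \<rho> g * \<rho> h"
  by (auto simp: is_rep_def hom_def units_of_def ring_mat_simps)

lemma is_rep_one:
  assumes "is_rep G n \<rho>"
  shows "\<rho> \<one> = 1\<^sub>m n"
proof -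
  interpret R: ring "ring_mat TYPE(complex) n ()" by (rule ring_mat)
  have "group (GL_complex n)" by (rule R.units_group)
  then have "group_hom G (GL_complex n) \<rho>"
    using assms by (auto simp: group_hom_def group_hom_axioms_def is_rep_def)
  from group_hom.hom_one[OF this] show ?thesis by (simp add: units_of_def ring_mat_simps)
qed

lemma is_rep_inv:
  assumes "is_rep G n \<rho>" "g \<in> carrier G"
  shows "\<rho> g * \<rho> (inv g) = 1\<^sub>m n" "\<rho> (inv g) * \<rho> g = 1\<^sub>m n"
  using is_rep_mult[OF assms(1), of g "inv g"] is_rep_mult[OF assms(1), of "inv g" g] assms
  by (auto simp: is_rep_one)

text \<open>Each matrix is a unit because the image of the inverse element inverts it.\<close>

lemma is_repI:
  assumes "\<And>g. g \<in> carrier G \<Longrightarrow> \<rho> g \<in> carrier_mat n n"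
    "\<And>g h. g \<in> carrier G \<Longrightarrow> h \<in> carrier G \<Longrightarrow> \<rho> (g \<otimes> h) = \<rho> g * \<rho> h" "\<rho> \<one> = 1\<^sub>m n"
  shows "is_rep G n \<rho>"
proof -
  have "\<rho> g \<in> Units (ring_mat TYPE(complex) n ())" if g: "g \<in> carrier G" for g
    unfolding Units_def
    using assms(1)[OF g] assms(1)[of "inv g"] assms(2)[of g "inv g"] assms(2)[of "inv g" g] assms(3) g
    by (auto simp: ring_mat_simps intro!: bexI[of _ "\<rho> (inv g)"])
  then show ?thesis using assms by (auto simp: is_rep_def hom_def units_of_def ring_mat_simps)
qed

text \<open>Schur's lemma. The kernel of \<open>T\<close> is invariant under \<open>\<sigma>\<close>
  and its range under \<open>\<rho>\<close>; irreducibility leaves only a zero kernel and the full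
  range once \<open>T\<close> is nonzero.\<close>

lemma intertwiner_zero_or_invertible:
  assumes \<rho>: "is_irr_rep G n \<rho>" and \<sigma>: "is_irr_rep G m \<sigma>" and T: "T \<in> carrier_mat n m"
    and comm: "\<And>g. g \<in> carrier G \<Longrightarrow> \<rho> g * T = T * \<sigma> g"
    and nz: "T \<noteq> 0\<^sub>m n m"
  obtains S where "n = m" "S \<in> carrier_mat n n" "T * S = 1\<^sub>m n" "S * T = 1\<^sub>m n"
proof -
  note c = is_irr_rep_carrier[OF \<rho>] is_irr_rep_carrier[OF \<sigma>]
  have cv: "\<rho> g *\<^sub>v (T *\<^sub>v x) = T *\<^sub>v (\<sigma> g *\<^sub>v x)" if "g \<in> carrier G" "x \<in> carrier_vec m" for g x
    using comm[OF that(1)] assoc_mult_mat_vec[OF c(1)[OF that(1)] T that(2)]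
      assoc_mult_mat_vec[OF T c(2)[OF that(1)] that(2)] by simp
  let ?K = "{x \<in> carrier_vec m. T *\<^sub>v x = 0\<^sub>v n}"
  have "\<sigma> g *\<^sub>v x \<in> ?K" if "g \<in> carrier G" "x \<in> ?K" for g x
    using that cv[of g x, symmetric] c(2)[of g] mult_mat_vec_0[OF c(1)[of g]] by auto
  then have K: "?K = {0\<^sub>v m} \<or> ?K = carrier_vec m"
    using \<sigma> vec_subspace_kernel[OF T] unfolding is_irr_rep_def by blast
  have nK: "?K \<noteq> carrier_vec m"
  proof
    assume e: "?K = carrier_vec m"
    have "T $$ (i,j) = 0" if ij: "i < n" "j < m" for i j
    proof -
      have "unit_vec m j \<in> ?K" unfolding e by simp
      then have "col T j = 0\<^sub>v n" using mult_mat_unit_vec[OF T ij(2)] by simp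
      then have "col T j $ i = 0" using ij by simp
      then show ?thesis using ij T by simp
    qed
    then show False using nz T by auto
  qed
  have inj: "inj_mat T"
    using K nK T unfolding inj_mat_def by auto
  have "\<rho> g *\<^sub>v y \<in> mat_range T" if "g \<in> carrier G" "y \<in> mat_range T" for g y
  proof -
    from that(2) obtain x where x: "x \<in> carrier_vec m" "y = T *\<^sub>v x"
      unfolding mat_range_carrier[OF T] by auto
    have "\<sigma> g *\<^sub>v x \<in> carrier_vec m" using c(2)[OF that(1)] x(1) by simp
    then show ?thesis unfolding mat_range_carrier[OF T] x(2) cv[OF that(1) x(1)] by (rule imageI)
  qed
  then have "mat_range T = {0\<^sub>v n} \<or> mat_range T = carrier_vec n"
    using \<rho> vec_subspace_mat_range[OF T] unfolding is_irr_rep_def by blast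
  moreover have "mat_range T \<noteq> {0\<^sub>v n}"
    using nK T unfolding mat_range_carrier[OF T] by auto
  ultimately have R: "mat_range T = carrier_vec n" by blast
  \<comment> \<open>Surjectivity is turned into a right inverse by solving for each unit vector.
    This \<open>S\<close> is injective as well, so comparing dimensions in both directions gives
    \<open>n = m\<close>.\<close>
  obtain S where S: "S \<in> carrier_mat m n" and TS: "T * S = 1\<^sub>m n"
    using mat_factor[OF T one_carrier_mat] R by (metis col_one unit_vec_carrier)
  have "inj_mat S" unfolding inj_mat_def
  proof (intro ballI impI)
    fix x assume "x \<in> carrier_vec (dim_col S)" "S *\<^sub>v x = 0\<^sub>v (dim_row S)"
    then have x: "x \<in> carrier_vec n" "S *\<^sub>v x = 0\<^sub>v m" using S by auto
    have "x = T *\<^sub>v (S *\<^sub>v x)" using TS x(1) assoc_mult_mat_vec[OF T S x(1)] by simp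
    then show "x = 0\<^sub>v (dim_col S)" using x(2) T S by simp
  qed
  then have nm: "n = m" using inj_mat_dims[OF inj T] inj_mat_dims[of S m n] S by simp
  then have "S * T = 1\<^sub>m n" using mat_mult_left_right_inverse[OF _ _ TS] T S by simp
  with nm S TS that show thesis by simp
qed

text \<open>Over the complex numbers \<open>T\<close> has an eigenvalue \<open>c\<close>. The matrix
  \<open>T\<close> minus \<open>c\<close> times the identity still commutes with the representation
  but kills an eigenvector, so it is not invertible and must be zero.\<close>

lemma schur_scalar:
  assumes \<rho>: "is_irr_rep G n \<rho>" and T: "T \<in> carrier_mat n n"
    and comm: "\<And>g. g \<in> carrier G \<Longrightarrow> \<rho> g * T = T * \<rho> g"
  obtains c where "T = c \<cdot>\<^sub>m 1\<^sub>m n"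
proof -
  have "n > 0" using \<rho> by (simp add: is_irr_rep_def)
  then obtain c where c: "eigenvalue T c"
    using spectrum_non_empty[OF T] by (auto simp: spectrum_def)
  let ?T = "T - c \<cdot>\<^sub>m 1\<^sub>m n"
  have dT: "?T \<in> carrier_mat n n" using T by (intro minus_carrier_mat) simp
  obtain v where v: "v \<in> carrier_vec n" "v \<noteq> 0\<^sub>v n" "T *\<^sub>v v = c \<cdot>\<^sub>v v"
    using c T by (auto simp: eigenvalue_def eigenvector_def)
  have smult: "(c \<cdot>\<^sub>m 1\<^sub>m n) *\<^sub>v v = c \<cdot>\<^sub>v v"
    using v by (intro eq_vecI) auto
  have kv: "?T *\<^sub>v v = 0\<^sub>v n"
    using T v smult by (subst minus_mult_distrib_mat_vec[of _ n n]) auto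
  have "?T = 0\<^sub>m n n"
  proof (rule ccontr)
    assume "?T \<noteq> 0\<^sub>m n n"
    moreover have "\<rho> g * ?T = ?T * \<rho> g" if g: "g \<in> carrier G" for g
      using comm[OF g] T is_irr_rep_carrier[OF \<rho> g]
      by (simp add: mult_minus_distrib_mat[of _ n n _ n] minus_mult_distrib_mat[of _ n n _ _ n]
          mult_smult_distrib[of _ n n _ n] mult_smult_assoc_mat[of _ n n _ n])
    ultimately obtain S where "S \<in> carrier_mat n n" "S * ?T = 1\<^sub>m n"
      using intertwiner_zero_or_invertible[OF \<rho> \<rho> dT] by blast
    then have "v = S *\<^sub>v (?T *\<^sub>v v)" using v dT by (simp flip: assoc_mult_mat_vec)
    then show False using kv v \<open>S \<in> carrier_mat n n\<close> by simp
  qed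
  then have z: "?T $$ (i,j) = 0" if "i < n" "j < n" for i j using that by simp
  have "T = c \<cdot>\<^sub>m 1\<^sub>m n"
  proof (rule eq_matI)
    fix i j assume "i < dim_row (c \<cdot>\<^sub>m 1\<^sub>m n)" "j < dim_col (c \<cdot>\<^sub>m 1\<^sub>m n)"
    then have ij: "i < n" "j < n" by simp_all
    show "T $$ (i,j) = (c \<cdot>\<^sub>m 1\<^sub>m n) $$ (i,j)" using z[OF ij] ij T by simp
  qed (use T in auto)
  with that show thesis .
qed

section \<open>Averaging over the group and orthogonality of traces\<close>

lemma bij_betw_mult_left: "h \<in> carrier G \<Longrightarrow> bij_betw (\<lambda>g. h \<otimes> g) (carrier G) (carrier G)"
  by (rule bij_betwI[of _ _ _ "\<lambda>g. inv h \<otimes> g"]) (auto simp: m_assoc[symmetric])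

text \<open>Left multiplication by \<open>h\<close> permutes the summands: replacing
  \<open>g\<close> by \<open>h \<otimes> g\<close> absorbs \<open>\<rho> h\<close> on the left and
  releases \<open>\<sigma> h\<close> on the right. Any \<open>X\<close> thus yields an intertwiner
  to which Schur's lemma applies.\<close>

lemma averaged_intertwines:
  assumes \<rho>: "is_rep G n \<rho>" and \<sigma>: "is_rep G m \<sigma>" and X: "X \<in> carrier_mat n m" and h: "h \<in> carrier G"
  defines "T \<equiv> mat_sum n m (\<lambda>g. \<rho> g * X * \<sigma> (inv g)) (carrier G)"
  shows "\<rho> h * T = T * \<sigma> h"
proof -
  note c = is_rep_carrier[OF \<rho>] is_rep_carrier[OF \<sigma>]
  have c': "\<rho> g * X * \<sigma> (inv g) \<in> carrier_mat n m" if "g \<in> carrier G" for g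
    using c[of g] c[of "inv g"] that X by auto
  have "\<rho> h * T = mat_sum n m (\<lambda>g. \<rho> h * (\<rho> g * X * \<sigma> (inv g))) (carrier G)"
    unfolding T_def by (rule mult_mat_sum[OF c(1)[OF h] c'])
  also have "\<dots> = mat_sum n m (\<lambda>g. (\<rho> (h \<otimes> g) * X * \<sigma> (inv (h \<otimes> g))) * \<sigma> h) (carrier G)"
  proof (rule mat_sum_cong)
    fix g assume g: "g \<in> carrier G"
    have "inv (h \<otimes> g) \<otimes> h = inv g" using g h by (simp add: inv_mult_group m_assoc)
    then have "\<sigma> (inv g) = \<sigma> (inv (h \<otimes> g)) * \<sigma> h"
      using is_rep_mult[OF \<sigma>, of "inv (h \<otimes> g)" h] g h by simp
    moreover have "\<rho> (h \<otimes> g) = \<rho> h * \<rho> g" using is_rep_mult[OF \<rho>] g h by simp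
    ultimately show "\<rho> h * (\<rho> g * X * \<sigma> (inv g)) = (\<rho> (h \<otimes> g) * X * \<sigma> (inv (h \<otimes> g))) * \<sigma> h"
      using c(1)[OF g] c(1)[OF h] c(2)[OF h] c(2)[of "inv (h \<otimes> g)"] X g h
      by (simp add: assoc_mult_mat[of _ n n _ n _ m] assoc_mult_mat[of _ n n _ m _ m] assoc_mult_mat[of _ n m _ m _ m])
  qed
  also have "\<dots> = mat_sum n m (\<lambda>g. (\<rho> g * X * \<sigma> (inv g)) * \<sigma> h) (carrier G)"
    by (rule mat_sum_reindex[OF bij_betw_mult_left[OF h], symmetric])
  also have "\<dots> = T * \<sigma> h"
    unfolding T_def by (rule mat_sum_mult[OF c(2)[OF h] c', symmetric])
  finally show ?thesis .
qed

lemma is_rep_pow: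
  assumes "is_rep G n \<rho>" "g \<in> carrier G"
  shows "\<rho> (g [^] (k::nat)) = \<rho> g ^\<^sub>m k"
  using is_rep_mult[OF assms(1)] is_rep_one[OF assms(1)] is_rep_carrier[OF assms(1)] assms(2)
  by (induction k) auto

text \<open>The matrix \<open>\<rho> g\<close> is a root of the identity with exponent the group
  order, and \<open>inv g\<close> is the power of \<open>g\<close> with that exponent less one; both
  claims are then facts about the trace of a matrix of finite order.\<close>

lemma
  assumes fin: "finite (carrier G)" and \<rho>: "is_rep G n \<rho>" and g: "g \<in> carrier G"
  shows cmod_trace_rep_le: "cmod (mat_trace (\<rho> g)) \<le> real n"
    and mat_trace_rep_inv: "mat_trace (\<rho> (inv g)) = cnj (mat_trace (\<rho> g))"
proof -
  let ?N = "Coset.order G"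
  have N: "?N > 0" using fin by (simp add: order_gt_0_iff_finite)
  have one: "\<rho> g ^\<^sub>m ?N = 1\<^sub>m n"
    using is_rep_pow[OF \<rho> g, of ?N] pow_order_eq_1[OF g] is_rep_one[OF \<rho>] by simp
  have "g [^] (?N - 1) \<otimes> g = \<one>"
    using N pow_order_eq_1[OF g] g by (metis Suc_diff_1 nat_pow_Suc)
  then have i: "inv g = g [^] (?N - 1)" using g by (intro inv_equality) auto
  note * = trace_root_of_one[OF is_rep_carrier[OF \<rho> g] one N]
  show "cmod (mat_trace (\<rho> g)) \<le> real n" by (rule *(1))
  show "mat_trace (\<rho> (inv g)) = cnj (mat_trace (\<rho> g))"
    unfolding i is_rep_pow[OF \<rho> g] by (rule *(2))
qed

lemma mat_trace_rep_conj:
  assumes \<rho>: "is_rep G n \<rho>" and g: "g \<in> carrier G" and x: "x \<in> carrier G"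
  shows "mat_trace (\<rho> (g \<otimes> x \<otimes> inv g)) = mat_trace (\<rho> x)"
proof -
  have c: "\<rho> g \<in> carrier_mat n n" "\<rho> x \<in> carrier_mat n n" "\<rho> (inv g) \<in> carrier_mat n n"
    using is_rep_carrier[OF \<rho>] g x by auto
  have "mat_trace (\<rho> (g \<otimes> x \<otimes> inv g)) = mat_trace ((\<rho> g * \<rho> x) * \<rho> (inv g))"
    using is_rep_mult[OF \<rho>] g x by simp
  also have "\<dots> = mat_trace (\<rho> (inv g) * (\<rho> g * \<rho> x))"
    by (rule mat_trace_comm[of _ n n]) (use c in auto)
  also have "\<rho> (inv g) * (\<rho> g * \<rho> x) = \<rho> x"
    using c is_rep_inv(2)[OF \<rho> g] by (simp flip: assoc_mult_mat[of _ n n _ n _ n])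
  finally show ?thesis .
qed

text \<open>The product of the \<open>i\<close>-th diagonal entry of \<open>\<rho> g\<close> and the
  \<open>l\<close>-th of \<open>\<sigma> (inv g)\<close> is the (i,l) entry of the sandwiched matrix
  unit. Orthogonality is thereby reduced to averaged intertwiners.\<close>

lemma sum_trace_trace:
  assumes \<rho>: "is_rep G n \<rho>" and \<sigma>: "is_rep G m \<sigma>"
  shows "(\<Sum>g\<in>carrier G. mat_trace (\<rho> g) * mat_trace (\<sigma> (inv g))) =
    (\<Sum>i<n. \<Sum>l<m. mat_sum n m (\<lambda>g. \<rho> g * elem_mat n m i l * \<sigma> (inv g)) (carrier G) $$ (i,l))"
proof -
  have "(\<Sum>g\<in>carrier G. mat_trace (\<rho> g) * mat_trace (\<sigma> (inv g)))
     = (\<Sum>g\<in>carrier G. \<Sum>i<n. \<Sum>l<m. (\<rho> g * elem_mat n m i l * \<sigma> (inv g)) $$ (i,l))"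
  proof (rule sum.cong[OF refl])
    fix g assume g: "g \<in> carrier G"
    then have c: "\<rho> g \<in> carrier_mat n n" "\<sigma> (inv g) \<in> carrier_mat m m"
      using is_rep_carrier[OF \<rho>] is_rep_carrier[OF \<sigma>] by auto
    then have "mat_trace (\<rho> g) * mat_trace (\<sigma> (inv g)) = (\<Sum>i<n. \<Sum>l<m. \<rho> g $$ (i,i) * \<sigma> (inv g) $$ (l,l))"
      by (auto simp: mat_trace_def sum_product)
    also have "\<dots> = (\<Sum>i<n. \<Sum>l<m. (\<rho> g * elem_mat n m i l * \<sigma> (inv g)) $$ (i,l))"
      using c by (auto simp: mult_elem_mat_mult intro!: sum.cong simp del: index_mult_mat)
    finally show "mat_trace (\<rho> g) * mat_trace (\<sigma> (inv g)) =
      (\<Sum>i<n. \<Sum>l<m. (\<rho> g * elem_mat n m i l * \<sigma> (inv g)) $$ (i,l))" .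
  qed
  also have "\<dots> = (\<Sum>i<n. \<Sum>g\<in>carrier G. \<Sum>l<m. (\<rho> g * elem_mat n m i l * \<sigma> (inv g)) $$ (i,l))"
    by (rule sum.swap)
  also have "\<dots> = (\<Sum>i<n. \<Sum>l<m. \<Sum>g\<in>carrier G. (\<rho> g * elem_mat n m i l * \<sigma> (inv g)) $$ (i,l))"
    by (intro sum.cong refl sum.swap)
  also have "\<dots> = (\<Sum>i<n. \<Sum>l<m. mat_sum n m (\<lambda>g. \<rho> g * elem_mat n m i l * \<sigma> (inv g)) (carrier G) $$ (i,l))"
    by (intro sum.cong refl) (auto simp: mat_sum_index)
  finally show ?thesis .
qed

text \<open>A nonzero averaged intertwiner would be invertible, hence a witness that the two
  representations are equivalent. So all of them vanish.\<close>

lemma trace_orthogonal: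
  assumes \<rho>: "is_irr_rep G n \<rho>" and \<sigma>: "is_irr_rep G m \<sigma>" and ne: "(\<rho>, \<sigma>) \<notin> irr_rep_equiv G"
  shows "(\<Sum>g\<in>carrier G. mat_trace (\<rho> g) * mat_trace (\<sigma> (inv g))) = 0"
proof -
  note r = is_irr_rep_rep[OF \<rho>] is_irr_rep_rep[OF \<sigma>]
  have "mat_sum n m (\<lambda>g. \<rho> g * X * \<sigma> (inv g)) (carrier G) = 0\<^sub>m n m" (is "?T = _")
    if X: "X \<in> carrier_mat n m" for X
  proof (rule ccontr)
    assume "?T \<noteq> 0\<^sub>m n m"
    then obtain S where S: "n = m" "S \<in> carrier_mat n n" "?T * S = 1\<^sub>m n" "S * ?T = 1\<^sub>m n"
      using intertwiner_zero_or_invertible[OF \<rho> \<sigma> mat_sum_carrier averaged_intertwines[OF r X]]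
      by blast
    have T: "?T \<in> carrier_mat n n" using S(1) by (simp del: mat_sum_carrier) (metis mat_sum_carrier)
    have "similar_mat_wit (\<rho> g) (\<sigma> g) ?T S" if g: "g \<in> carrier G" for g
    proof -
      have c: "\<rho> g \<in> carrier_mat n n" "\<sigma> g \<in> carrier_mat n n"
        using is_rep_carrier[OF r(1) g] is_rep_carrier[OF r(2) g] S(1) by auto
      have "?T * \<sigma> g * S = \<rho> g * ?T * S" using averaged_intertwines[OF r X g] by simp
      also have "\<dots> = \<rho> g" using S(2,3) c T by (simp add: assoc_mult_mat[of _ n n _ n _ n])
      finally show ?thesis
        using c T S by (intro similar_mat_witI[of _ _ n]) auto
    qed
    then have "(\<rho>, \<sigma>) \<in> irr_rep_equiv G"
      using \<rho> \<sigma> by (auto simp: irr_rep_equiv_def irr_reps_def)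
    with ne show False by simp
  qed
  then show ?thesis unfolding sum_trace_trace[OF r] by simp
qed

text \<open>The average of the matrix unit at (i,l) is a scalar matrix. Its trace is the group order
  if \<open>i = l\<close> and 0 otherwise, since every summand is similar to the matrix unit. Each
  of the \<open>n\<close> diagonal pairs therefore contributes the order divided by
  \<open>n\<close>.\<close>

lemma trace_orthonormal:
  assumes fin: "finite (carrier G)" and \<rho>: "is_irr_rep G n \<rho>"
  shows "(\<Sum>g\<in>carrier G. mat_trace (\<rho> g) * mat_trace (\<rho> (inv g))) = of_nat (Coset.order G)"
proof -
  note r = is_irr_rep_rep[OF \<rho>]
  have n: "n > 0" using \<rho> by (simp add: is_irr_rep_def)
  have "mat_sum n n (\<lambda>g. \<rho> g * elem_mat n n i l * \<rho> (inv g)) (carrier G) $$ (i,l) =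
     (if i = l then of_nat (Coset.order G) / of_nat n else 0)" (is "?T $$ _ = _")
    if il: "i < n" "l < n" for i l
  proof -
    obtain c where c: "?T = c \<cdot>\<^sub>m 1\<^sub>m n"
      using schur_scalar[OF \<rho> mat_sum_carrier averaged_intertwines[OF r r elem_mat_carrier]] by blast
    have "of_nat n * c = mat_trace ?T" unfolding c by (simp add: mat_trace_def)
    also have "\<dots> = (\<Sum>g\<in>carrier G. mat_trace (\<rho> g * elem_mat n n i l * \<rho> (inv g)))"
      by (rule mat_trace_mat_sum) (use is_rep_carrier[OF r] in \<open>auto intro!: mult_carrier_mat[of _ n n]\<close>)
    also have "\<dots> = (\<Sum>g\<in>carrier G. mat_trace (elem_mat n n i l :: complex mat))"
    proof (rule sum.cong[OF refl])
      fix g assume g: "g \<in> carrier G"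
      have cc: "\<rho> g \<in> carrier_mat n n" "\<rho> (inv g) \<in> carrier_mat n n" using is_rep_carrier[OF r] g by auto
      have "similar_mat_wit (\<rho> g * elem_mat n n i l * \<rho> (inv g)) (elem_mat n n i l) (\<rho> g) (\<rho> (inv g))"
        using cc is_rep_inv[OF r g] by (intro similar_mat_witI[of _ _ n]) auto
      then show "mat_trace (\<rho> g * elem_mat n n i l * \<rho> (inv g)) = mat_trace (elem_mat n n i l :: complex mat)"
        by (rule mat_trace_similar)
    qed
    also have "mat_trace (elem_mat n n i l :: complex mat) = (\<Sum>p<n. if p = i then (if i = l then 1 else 0) else 0)"
      by (auto simp: mat_trace_def elem_mat_def intro!: sum.cong)
    also have "\<dots> = (if i = l then 1 else 0)" using il by simp
    finally have "of_nat n * c = (if i = l then of_nat (Coset.order G) else 0)"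
      by (simp add: Coset.order_def)
    then have "c = (if i = l then of_nat (Coset.order G) / of_nat n else 0)"
      using n by (auto simp: field_simps split: if_splits)
    then show ?thesis unfolding c using il by simp
  qed
  then show ?thesis unfolding sum_trace_trace[OF r r] using n
    by (simp add: sum.delta)
qed

section \<open>Irreducible subrepresentations and the action of the group algebra\<close>

text \<open>Among the nonzero invariant subspaces of \<open>W\<close> take one of least dimension,
  with a basis as the columns of \<open>P\<close>. Factoring \<open>R g * P\<close> through
  \<open>P\<close> defines \<open>\<sigma> g\<close>.\<close>

lemma irreducible_subrep:
  assumes R: "is_rep G N R" and W: "vec_subspace N W" "W \<noteq> {0\<^sub>v N}"
    and inv: "\<And>g w. g \<in> carrier G \<Longrightarrow> w \<in> W \<Longrightarrow> R g *\<^sub>v w \<in> W"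
  obtains m \<sigma> P where "is_irr_rep G m \<sigma>" "P \<in> carrier_mat N m" "inj_mat P" "mat_range P \<subseteq> W"
    "\<And>g. g \<in> carrier G \<Longrightarrow> R g * P = P * \<sigma> g"
proof -
  note cR = is_rep_carrier[OF R]
  define Q where "Q m \<longleftrightarrow> m > 0 \<and> (\<exists>P \<in> carrier_mat N m. inj_mat P \<and> mat_range P \<subseteq> W \<and>
     (\<forall>g \<in> carrier G. \<forall>x \<in> mat_range P. R g *\<^sub>v x \<in> mat_range P))" for m
  obtain m0 P0 where P0: "P0 \<in> carrier_mat N m0" "inj_mat P0" "mat_range P0 = W"
    using vec_subspace_basis[OF W(1)] by blast
  have range0: "mat_range P = {0\<^sub>v n}" if "P \<in> carrier_mat n 0" for P :: "complex mat" and n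
  proof -
    have "P *\<^sub>v x = 0\<^sub>v n" if "x \<in> carrier_vec 0" for x
      using that \<open>P \<in> _\<close> by (intro eq_vecI) (auto simp: scalar_prod_def)
    then show ?thesis unfolding mat_range_carrier[OF that] by (auto intro!: image_eqI[of _ _ "0\<^sub>v 0"])
  qed
  have "m0 > 0" using range0[of P0 N] P0 W(2) by (cases m0) auto
  then have "Q m0" unfolding Q_def using P0 inv by auto
  then have "Q (Least Q)" by (rule LeastI)
  define m where "m = Least Q"
  have m: "m > 0" using \<open>Q (Least Q)\<close> by (simp add: Q_def m_def)
  obtain P where P: "P \<in> carrier_mat N m" "inj_mat P" "mat_range P \<subseteq> W"
    and Pinv: "\<And>g x. g \<in> carrier G \<Longrightarrow> x \<in> mat_range P \<Longrightarrow> R g *\<^sub>v x \<in> mat_range P"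
    using \<open>Q (Least Q)\<close> unfolding Q_def m_def[symmetric] by blast
  have "\<exists>T. g \<in> carrier G \<longrightarrow> T \<in> carrier_mat m m \<and> R g * P = P * T" for g
  proof (cases "g \<in> carrier G")
    case True
    have "col (R g * P) j \<in> mat_range P" if j: "j < m" for j
    proof -
      have "col P j = P *\<^sub>v unit_vec m j" using mult_mat_unit_vec[OF P(1) j] by simp
      then have "col P j \<in> mat_range P" unfolding mat_range_carrier[OF P(1)] by auto
      then show ?thesis unfolding col_mult2[OF cR[OF True] P(1) j] by (rule Pinv[OF True])
    qed
    from mat_factor[OF P(1) mult_carrier_mat[OF cR[OF True] P(1)] this] show ?thesis by metis
  qed auto
  then obtain \<sigma> where \<sigma>: "\<And>g. g \<in> carrier G \<Longrightarrow> \<sigma> g \<in> carrier_mat m m"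
    and com: "\<And>g. g \<in> carrier G \<Longrightarrow> R g * P = P * \<sigma> g" by metis
  have rep: "is_rep G m \<sigma>"
  proof (rule is_repI)
    fix g h assume gh: "g \<in> carrier G" "h \<in> carrier G"
    have "P * \<sigma> (g \<otimes> h) = R g * (R h * P)"
      using com[of "g \<otimes> h"] gh is_rep_mult[OF R gh] cR P(1) by (simp add: assoc_mult_mat[of _ N N _ N _ m])
    also have "\<dots> = (R g * P) * \<sigma> h"
      using com[OF gh(2)] cR[OF gh(1)] P(1) \<sigma>[OF gh(2)] by (simp add: assoc_mult_mat[of _ N N _ m _ m])
    also have "\<dots> = P * (\<sigma> g * \<sigma> h)"
      using com[OF gh(1)] P(1) \<sigma> gh by (simp add: assoc_mult_mat[of _ N m _ m _ m])
    \<comment> \<open>Injectivity of \<open>P\<close> pulls the homomorphism law of \<open>R\<close>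
      back to \<open>\<sigma>\<close>.\<close>
    finally show "\<sigma> (g \<otimes> h) = \<sigma> g * \<sigma> h"
      by (rule inj_mat_cancel[OF P(2,1), rotated 2]) (use \<sigma> gh in \<open>auto intro: mult_carrier_mat[of _ m m]\<close>)
  next
    show "\<sigma> \<one> = 1\<^sub>m m"
      by (rule inj_mat_cancel[OF P(2,1) _ _, of _ m]) (use \<sigma>[of \<one>] com[of \<one>] is_rep_one[OF R] P(1) in auto)
  qed (rule \<sigma>)
  have "U = {0\<^sub>v m} \<or> U = carrier_vec m"
    if U: "vec_subspace m U" and Uinv: "\<forall>g \<in> carrier G. \<forall>w \<in> U. \<sigma> g *\<^sub>v w \<in> U" for U
  proof -
    obtain k B where B: "B \<in> carrier_mat m k" "inj_mat B" "mat_range B = U"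
      using vec_subspace_basis[OF U] by blast
    have Uc: "U \<subseteq> carrier_vec m" using U by (simp add: vec_subspace_iff)
    have rPB: "mat_range (P * B) = (\<lambda>x. P *\<^sub>v x) ` U" unfolding mat_range_mult[OF P(1) B(1)] B(3) ..
    have "R g *\<^sub>v x \<in> mat_range (P * B)" if g: "g \<in> carrier G" and x: "x \<in> mat_range (P * B)" for g x
    proof -
      obtain u where u: "u \<in> U" "x = P *\<^sub>v u" using x unfolding rPB by auto
      then have uc: "u \<in> carrier_vec m" using Uc by auto
      have "R g *\<^sub>v x = P *\<^sub>v (\<sigma> g *\<^sub>v u)"
        using assoc_mult_mat_vec[OF cR[OF g] P(1) uc] assoc_mult_mat_vec[OF P(1) \<sigma>[OF g] uc] com[OF g] u by simp
      then show ?thesis unfolding rPB using Uinv g u(1) by auto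
    qed
    moreover have "mat_range (P * B) \<subseteq> W"
      using P(3) Uc unfolding rPB mat_range_carrier[OF P(1)] by auto
    moreover have "inj_mat (P * B)" by (rule inj_mat_mult[OF P(1,2) B(1,2)])
    \<comment> \<open>The image under \<open>P\<close> of an invariant subspace of
      \<open>\<sigma>\<close> competes with \<open>P\<close> itself in the choice of the least
      dimension, so \<open>k\<close> is 0 or at least \<open>m\<close>.\<close>
    ultimately have "k > 0 \<Longrightarrow> Q k" unfolding Q_def using mult_carrier_mat[OF P(1) B(1)] by blast
    then have "k > 0 \<Longrightarrow> m \<le> k" unfolding m_def by (auto intro: Least_le)
    then consider "k = 0" | "k = m" using inj_mat_dims[OF B(2,1)] by fastforce
    then show ?thesis
    proof cases
      case 1
      then show ?thesis using range0 B by auto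
    next
      case 2
      then show ?thesis using mat_range_full_if_square[of B m] B by auto
    qed
  qed
  then have "is_irr_rep G m \<sigma>" using rep m by (simp add: is_irr_rep_def)
  then show thesis by (rule that[OF _ P com])
qed

text \<open>The linear extension of \<open>\<rho>\<close> to the group algebra, evaluated at the
  element with coefficients \<open>f\<close>.\<close>

definition rep_extend :: "nat \<Rightarrow> ('a \<Rightarrow> complex mat) \<Rightarrow> ('a \<Rightarrow> complex) \<Rightarrow> complex mat" where
  "rep_extend n \<rho> f = mat_sum n n (\<lambda>g. f g \<cdot>\<^sub>m \<rho> g) (carrier G)"

lemma rep_extend_carrier: "rep_extend n \<rho> f \<in> carrier_mat n n"
  by (simp add: rep_extend_def)

text \<open>A class function is a central element of the group algebra; concretely, the sum is
  reindexed by conjugation with \<open>h\<close>.\<close>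

lemma rep_extend_comm:
  assumes \<rho>: "is_rep G n \<rho>" and h: "h \<in> carrier G"
    and cl: "\<And>g x. g \<in> carrier G \<Longrightarrow> x \<in> carrier G \<Longrightarrow> f (g \<otimes> x \<otimes> inv g) = f x"
  shows "\<rho> h * rep_extend n \<rho> f = rep_extend n \<rho> f * \<rho> h"
proof -
  note c = is_rep_carrier[OF \<rho>]
  have "rep_extend n \<rho> f * \<rho> h = mat_sum n n (\<lambda>g. (f g \<cdot>\<^sub>m \<rho> g) * \<rho> h) (carrier G)"
    unfolding rep_extend_def by (rule mat_sum_mult) (use c h in auto)
  also have "\<dots> = mat_sum n n (\<lambda>g. (f (h \<otimes> g \<otimes> inv h) \<cdot>\<^sub>m \<rho> (h \<otimes> g \<otimes> inv h)) * \<rho> h) (carrier G)"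
  proof (rule mat_sum_reindex)
    have i: "inv h \<otimes> (h \<otimes> x) = x" "h \<otimes> (inv h \<otimes> x) = x" if "x \<in> carrier G" for x
      using h that by (simp_all flip: m_assoc)
    show "bij_betw (\<lambda>g. h \<otimes> g \<otimes> inv h) (carrier G) (carrier G)"
      by (rule bij_betwI[of _ _ _ "\<lambda>g. inv h \<otimes> g \<otimes> h"]) (use h i in \<open>auto simp: m_assoc\<close>)
  qed
  also have "\<dots> = mat_sum n n (\<lambda>g. \<rho> h * (f g \<cdot>\<^sub>m \<rho> g)) (carrier G)"
  proof (rule mat_sum_cong)
    fix g assume g: "g \<in> carrier G"
    have "\<rho> (h \<otimes> g \<otimes> inv h) * \<rho> h = \<rho> (h \<otimes> g \<otimes> inv h \<otimes> h)"
      using is_rep_mult[OF \<rho>] g h by simp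
    also have "h \<otimes> g \<otimes> inv h \<otimes> h = h \<otimes> g" using g h by (simp add: m_assoc)
    finally have "\<rho> (h \<otimes> g \<otimes> inv h) * \<rho> h = \<rho> h * \<rho> g"
      using is_rep_mult[OF \<rho>] g h by simp
    then show "(f (h \<otimes> g \<otimes> inv h) \<cdot>\<^sub>m \<rho> (h \<otimes> g \<otimes> inv h)) * \<rho> h = \<rho> h * (f g \<cdot>\<^sub>m \<rho> g)"
      using c[of g] c[of h] c[of "h \<otimes> g \<otimes> inv h"] g h cl[OF h g]
      by (simp add: mult_smult_assoc_mat[of _ n n _ n] mult_smult_distrib[of _ n n _ n])
  qed
  also have "\<dots> = \<rho> h * rep_extend n \<rho> f"
    unfolding rep_extend_def by (rule mult_mat_sum[symmetric]) (use c h in auto)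
  finally show ?thesis by simp
qed

text \<open>By Schur's lemma the operator is a scalar \<open>k\<close>, and its trace
  \<open>n\<close> times \<open>k\<close> is exactly the sum assumed to be zero.\<close>

lemma rep_extend_irr_zero:
  assumes \<rho>: "is_irr_rep G n \<rho>"
    and cl: "\<And>g x. g \<in> carrier G \<Longrightarrow> x \<in> carrier G \<Longrightarrow> f (g \<otimes> x \<otimes> inv g) = f x"
    and z: "(\<Sum>g\<in>carrier G. f g * mat_trace (\<rho> g)) = 0"
  shows "rep_extend n \<rho> f = 0\<^sub>m n n"
proof -
  note r = is_irr_rep_rep[OF \<rho>]
  note c = is_rep_carrier[OF r]
  obtain k where k: "rep_extend n \<rho> f = k \<cdot>\<^sub>m 1\<^sub>m n"
    using schur_scalar[OF \<rho> rep_extend_carrier rep_extend_comm[OF r _ cl]] by blast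
  have "of_nat n * k = mat_trace (rep_extend n \<rho> f)" unfolding k by (simp add: mat_trace_def)
  also have "\<dots> = (\<Sum>g\<in>carrier G. mat_trace (f g \<cdot>\<^sub>m \<rho> g))"
    unfolding rep_extend_def by (rule mat_trace_mat_sum) (use c in auto)
  also have "\<dots> = (\<Sum>g\<in>carrier G. f g * mat_trace (\<rho> g))"
    using c by (intro sum.cong refl) (auto simp: mat_trace_def sum_distrib_left dest!: c intro!: sum.cong)
  finally have "k = 0" using z \<rho> by (simp add: is_irr_rep_def)
  then show ?thesis unfolding k by auto
qed

lemma rep_extend_intertwine:
  assumes R: "is_rep G N R" and \<sigma>: "is_rep G m \<sigma>" and P: "P \<in> carrier_mat N m"
    and com: "\<And>g. g \<in> carrier G \<Longrightarrow> R g * P = P * \<sigma> g"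
  shows "rep_extend N R f * P = P * rep_extend m \<sigma> f"
proof -
  note c = is_rep_carrier[OF R] is_rep_carrier[OF \<sigma>]
  have "rep_extend N R f * P = mat_sum N m (\<lambda>g. (f g \<cdot>\<^sub>m R g) * P) (carrier G)"
    unfolding rep_extend_def by (rule mat_sum_mult) (use c P in auto)
  also have "\<dots> = mat_sum N m (\<lambda>g. P * (f g \<cdot>\<^sub>m \<sigma> g)) (carrier G)"
    using c P com by (intro mat_sum_cong) (simp add: mult_smult_assoc_mat[of _ N N _ m] mult_smult_distrib[of _ N m _ m])
  also have "\<dots> = P * rep_extend m \<sigma> f"
    unfolding rep_extend_def by (rule mult_mat_sum[symmetric]) (use c P in auto)
  finally show ?thesis .
qed

end

subsection \<open>Irreducible characters of a finite group\<close>

locale finite_group = group +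
  assumes fin: "finite (carrier G)"
begin

text \<open>The operator of \<open>f\<close> on the regular representation has the entries \<open>f (x y\<^sup>-\<^sup>1)\<close>, so its adjoint
  is the operator of \<open>g \<mapsto> cnj (f (g\<^sup>-\<^sup>1))\<close>. An irreducible subrepresentation inside the range of the
  adjoint would be killed by the operator itself, hence be orthogonal to that range.\<close>

lemma class_function_zero:
  fixes f :: "'a \<Rightarrow> complex"
  assumes cl: "\<And>g x. g \<in> carrier G \<Longrightarrow> x \<in> carrier G \<Longrightarrow> f (g \<otimes> x \<otimes> inv g) = f x"
    and orth: "\<And>n \<sigma>. is_irr_rep G n \<sigma> \<Longrightarrow> (\<Sum>g\<in>carrier G. f g * mat_trace (\<sigma> g)) = 0"
    and x0: "x0 \<in> carrier G"
  shows "f x0 = 0"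
proof (rule ccontr)
  assume nz: "f x0 \<noteq> 0"
  define N where "N = card (carrier G)"
  obtain e where e: "bij_betw e {..<N} (carrier G)"
    using ex_bij_betw_nat_finite[OF fin] by (auto simp: N_def atLeast0LessThan)
  have ec: "e i \<in> carrier G" if "i < N" for i using e that by (auto simp: bij_betw_def)
  have einj: "e i = e j \<longleftrightarrow> i = j" if "i < N" "j < N" for i j
    using e that by (auto simp: bij_betw_def inj_on_def)
  have esurj: "\<exists>i<N. e i = g" if "g \<in> carrier G" for g
    using bij_betw_imp_surj_on[OF e] that by (auto simp flip: bij_betw_imp_surj_on[OF e])
  \<comment> \<open>The left regular representation in the basis enumerated by \<open>e\<close>:
    column \<open>j\<close> has its 1 in the row of \<open>g \<otimes> e j\<close>.\<close>
  define R :: "'a \<Rightarrow> complex mat"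
    where "R g = mat N N (\<lambda>(i,j). if e i = g \<otimes> e j then 1 else 0)" for g
  have Rc: "R g \<in> carrier_mat N N" for g by (simp add: R_def)
  have rep: "is_rep G N R"
  proof (rule is_repI[OF Rc])
    fix g h assume gh: "g \<in> carrier G" "h \<in> carrier G"
    show "R (g \<otimes> h) = R g * R h"
    proof (rule eq_matI)
      fix i j assume "i < dim_row (R g * R h)" "j < dim_col (R g * R h)"
      then have ij: "i < N" "j < N" using Rc[of g] Rc[of h] by auto
      obtain l0 where l0: "l0 < N" "e l0 = h \<otimes> e j" using esurj[of "h \<otimes> e j"] gh ec[OF ij(2)] by auto
      have "(R g * R h) $$ (i,j) = (\<Sum>l<N. R g $$ (i,l) * R h $$ (l,j))"
        using Rc[of g] Rc[of h] ij by (auto simp: scalar_prod_def atLeast0LessThan intro!: sum.cong)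
      also have "\<dots> = (\<Sum>l<N. if l = l0 then R g $$ (i,l0) else 0)"
        using ij einj[OF _ l0(1)] by (intro sum.cong) (auto simp: R_def simp flip: l0(2))
      also have "\<dots> = R g $$ (i,l0)" using l0 by simp
      also have "\<dots> = R (g \<otimes> h) $$ (i,j)"
        using ij l0 gh ec[OF ij(2)] by (simp add: R_def m_assoc)
      finally show "R (g \<otimes> h) $$ (i,j) = (R g * R h) $$ (i,j)" by simp
    qed (use Rc[of g] Rc[of h] Rc[of "g \<otimes> h"] in auto)
  next
    show "R \<one> = 1\<^sub>m N" using ec einj by (intro eq_matI) (auto simp: R_def)
  qed
  have ext: "rep_extend N R f $$ (i,j) = f (e i \<otimes> inv (e j))" if ij: "i < N" "j < N" for f i j
  proof -
    have "rep_extend N R f $$ (i,j) = (\<Sum>g\<in>carrier G. f g * (if e i = g \<otimes> e j then 1 else 0))"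
      unfolding rep_extend_def using ij by (simp add: mat_sum_index R_def)
    also have "\<dots> = (\<Sum>g\<in>carrier G. if g = e i \<otimes> inv (e j) then f (e i \<otimes> inv (e j)) else 0)"
      using ec[OF ij(1)] ec[OF ij(2)] by (intro sum.cong) (auto simp: m_assoc)
    also have "\<dots> = f (e i \<otimes> inv (e j))" using fin ec ij by simp
    finally show ?thesis .
  qed
  define f' where "f' g = cnj (f (inv g))" for g
  let ?U = "rep_extend N R f" and ?V = "rep_extend N R f'"
  have cl': "f' (g \<otimes> x \<otimes> inv g) = f' x" if "g \<in> carrier G" "x \<in> carrier G" for g x
    using cl[of g "inv x"] that by (simp add: f'_def inv_mult_group m_assoc)
  have adj: "?V $$ (i,j) = cnj (?U $$ (j,i))" if "i < N" "j < N" for i j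
    using that ec by (simp add: ext f'_def inv_mult_group)
  have U: "?U \<in> carrier_mat N N" and V: "?V \<in> carrier_mat N N" by (rule rep_extend_carrier)+
  let ?W = "mat_range ?V"
  have "R g *\<^sub>v w \<in> ?W" if g: "g \<in> carrier G" and w: "w \<in> ?W" for g w
  proof -
    obtain y where y: "y \<in> carrier_vec N" "w = ?V *\<^sub>v y" using w unfolding mat_range_carrier[OF V] by auto
    have "R g *\<^sub>v w = ?V *\<^sub>v (R g *\<^sub>v y)"
      using assoc_mult_mat_vec[OF Rc[of g] V y(1)] assoc_mult_mat_vec[OF V Rc[of g] y(1)]
        rep_extend_comm[OF rep g cl'] y by simp
    then show ?thesis unfolding mat_range_carrier[OF V] using y(1) Rc[of g] by auto
  qed
  moreover have "?W \<noteq> {0\<^sub>v N}"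
  proof
    assume W: "?W = {0\<^sub>v N}"
    \<comment> \<open>This entry of \<open>?V\<close> is \<open>f' (inv x0)\<close>, the conjugate
      of \<open>f x0\<close>, so a vanishing range contradicts the choice of
      \<open>x0\<close>.\<close>
    obtain i j where ij: "i < N" "e i = \<one>" "j < N" "e j = x0" using esurj[of \<one>] esurj[OF x0] by auto
    have "col ?V j \<in> ?W"
      using mult_mat_unit_vec[OF V ij(3)] unfolding mat_range_carrier[OF V]
      by (auto intro!: image_eqI[of _ _ "unit_vec N j"])
    have "?V $$ (i,j) = 0" using \<open>col ?V j \<in> ?W\<close> W V ij by (metis carrier_matD index_col index_zero_vec(1) singletonD)
    then show False using nz x0 ij by (simp add: ext f'_def)
  qed
  ultimately obtain m \<sigma> P where \<sigma>: "is_irr_rep G m \<sigma>" and P: "P \<in> carrier_mat N m" "inj_mat P" "mat_range P \<subseteq> ?W"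
    and com: "\<And>g. g \<in> carrier G \<Longrightarrow> R g * P = P * \<sigma> g"
    using irreducible_subrep[OF rep vec_subspace_mat_range[OF V]] by blast
  have m: "m > 0" using \<sigma> by (simp add: is_irr_rep_def)
  have "?U * P = P * 0\<^sub>m m m"
    using rep_extend_intertwine[OF rep is_irr_rep_rep[OF \<sigma>] P(1) com]
      rep_extend_irr_zero[OF \<sigma> cl orth[OF \<sigma>]] by simp
  then have UP: "?U * P = 0\<^sub>m N m" using P(1) by simp
  \<comment> \<open>The first column of \<open>P\<close>: it lies in the range of \<open>?V\<close>,
    is killed by \<open>?U\<close>, and is nonzero because \<open>P\<close> is injective and
    \<open>m > 0\<close>.\<close>
  define x where "x = P *\<^sub>v unit_vec m 0"
  have xc: "x \<in> carrier_vec N" using P by (simp add: x_def)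
  have "?U *\<^sub>v x = (?U * P) *\<^sub>v unit_vec m 0"
    unfolding x_def by (rule assoc_mult_mat_vec[OF U P(1), symmetric]) simp
  then have Ux: "?U *\<^sub>v x = 0\<^sub>v N" unfolding UP by (auto simp: scalar_prod_def)
  have "x \<in> ?W" using P(3) unfolding x_def mat_range_carrier[OF P(1)] by auto
  then obtain y where y: "y \<in> carrier_vec N" "x = ?V *\<^sub>v y" unfolding mat_range_carrier[OF V] by auto
  \<comment> \<open>With x = V y and U the adjoint of V, the squared norm of x is the inner product
    of U x with y, hence 0.\<close>
  have "complex_of_real (\<Sum>i<N. (cmod (x $ i))\<^sup>2) = (\<Sum>i<N. x $ i * cnj (\<Sum>j<N. ?V $$ (i,j) * y $ j))"
    unfolding of_real_sum complex_norm_square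
  proof (intro sum.cong refl)
    fix i assume "i \<in> {..<N}"
    then have "x $ i = (\<Sum>j<N. ?V $$ (i,j) * y $ j)"
      unfolding y(2) using V y(1) by (auto simp: scalar_prod_def atLeast0LessThan intro!: sum.cong)
    then show "x $ i * cnj (x $ i) = x $ i * cnj (\<Sum>j<N. ?V $$ (i,j) * y $ j)" by simp
  qed
  also have "\<dots> = (\<Sum>i<N. \<Sum>j<N. cnj (y $ j) * (?U $$ (j,i) * x $ i))"
    by (intro sum.cong refl) (auto simp: sum_distrib_left cnj_sum adj mult_ac)
  also have "\<dots> = (\<Sum>j<N. cnj (y $ j) * (\<Sum>i<N. ?U $$ (j,i) * x $ i))"
    by (subst sum.swap) (simp add: sum_distrib_left)
  also have "\<dots> = (\<Sum>j<N. cnj (y $ j) * (?U *\<^sub>v x) $ j)"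
    using U xc by (intro sum.cong refl) (auto simp: scalar_prod_def atLeast0LessThan intro!: sum.cong)
  also have "\<dots> = 0" unfolding Ux by simp
  finally have "(\<Sum>i<N. (cmod (x $ i))\<^sup>2) = 0" by (simp only: of_real_eq_0_iff)
  then have "\<forall>i<N. x $ i = 0" by (subst (asm) sum_nonneg_eq_0_iff) auto
  then have "x = 0\<^sub>v N" using xc by auto
  then have "unit_vec m 0 = (0\<^sub>v m :: complex vec)"
    using inj_matD[OF P(2,1), of "unit_vec m 0"] by (simp add: x_def)
  then show False using m by (metis unit_vec_nonzero)
qed

section \<open>Conjugacy classes\<close>

lemma conj_class_eq: "conj_class G h = (\<lambda>g. g \<otimes> h \<otimes> inv g) ` carrier G"
  by (auto simp: conj_class_def orbit_def)

lemma conj_class_subset: "h \<in> carrier G \<Longrightarrow> conj_class G h \<subseteq> carrier G"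
  by (auto simp: conj_class_eq)

lemma conj_class_self: "h \<in> carrier G \<Longrightarrow> h \<in> conj_class G h"
  unfolding conj_class_eq by (rule image_eqI[of _ _ \<one>]) auto

lemma conj_class_cong:
  assumes "h \<in> carrier G" "x \<in> conj_class G h"
  shows "conj_class G x = conj_class G h"
proof -
  have sub: "conj_class G y \<subseteq> conj_class G h" if "h \<in> carrier G" "y \<in> conj_class G h" for h y
  proof
    fix z assume "z \<in> conj_class G y"
    moreover have "y \<in> conj_class G h" by (rule that(2))
    ultimately obtain a b where ab: "a \<in> carrier G" "b \<in> carrier G" "y = a \<otimes> h \<otimes> inv a" "z = b \<otimes> y \<otimes> inv b"
      unfolding conj_class_eq by blast
    then have "z = (b \<otimes> a) \<otimes> h \<otimes> inv (b \<otimes> a)" using that(1) by (simp add: inv_mult_group m_assoc)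
    then show "z \<in> conj_class G h" using ab unfolding conj_class_eq by blast
  qed
  obtain a where a: "a \<in> carrier G" "x = a \<otimes> h \<otimes> inv a" using assms by (auto simp: conj_class_eq)
  have x: "x \<in> carrier G" using conj_class_subset assms by auto
  have "inv a \<otimes> (a \<otimes> h) = h" using a assms(1) by (simp flip: m_assoc)
  then have "h = inv a \<otimes> x \<otimes> inv (inv a)" using a assms(1) by (simp add: m_assoc)
  then have "h \<in> conj_class G x" unfolding conj_class_eq using a(1) by blast
  then show ?thesis using sub[OF assms] sub[OF x] by auto
qed

lemma finite_conj_class: "finite (conj_class G h)"
  using fin by (simp add: conj_class_eq)

lemma card_conj_class_pos: "h \<in> carrier G \<Longrightarrow> 0 < card (conj_class G h)"
  using conj_class_self finite_conj_class by (auto simp: card_gt_0_iff)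

lemma conj_class_eq_one: "h \<in> carrier G \<Longrightarrow> conj_class G h = {\<one>} \<longleftrightarrow> h = \<one>"
  using conj_class_self[of h] one_closed by (auto simp: conj_class_eq)

lemma finite_nonid_conj_classes: "finite (nonid_conj_classes G)"
  using fin by (simp add: nonid_conj_classes_def)

text \<open>Elements are grouped by their class. The fibre over \<open>A\<close> is
  \<open>A \<inter> S\<close>, because the identity lies in no class other than its own. It is used
  for \<open>H\<close> and for the whole carrier.\<close>

lemma sum_conj_class:
  fixes Q :: "'a set \<Rightarrow> 'c :: comm_semiring_1"
  assumes S: "S \<subseteq> carrier G"
  shows "(\<Sum>g\<in>S - {\<one>}. Q (conj_class G g)) = (\<Sum>A\<in>nonid_conj_classes G. of_nat (card (A \<inter> S)) * Q A)"
proof -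
  have "(\<Sum>g\<in>S - {\<one>}. Q (conj_class G g)) =
    (\<Sum>A\<in>nonid_conj_classes G. \<Sum>g\<in>{g \<in> S - {\<one>}. conj_class G g = A}. Q (conj_class G g))"
    by (rule sum.group[symmetric])
      (use S fin finite_subset conj_class_eq_one in \<open>auto simp: nonid_conj_classes_def finite_nonid_conj_classes\<close>)
  also have "\<dots> = (\<Sum>A\<in>nonid_conj_classes G. of_nat (card (A \<inter> S)) * Q A)"
  proof (rule sum.cong[OF refl])
    fix A assume "A \<in> nonid_conj_classes G"
    then obtain h where h: "h \<in> carrier G" "A = conj_class G h" "A \<noteq> {\<one>}"
      by (auto simp: nonid_conj_classes_def)
    have "\<one> \<notin> A" using conj_class_cong[OF h(1)] conj_class_eq_one[of \<one>] h by auto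
    then have e: "{g \<in> S - {\<one>}. conj_class G g = A} = A \<inter> S"
      using conj_class_cong[OF h(1)] conj_class_self S h(2) by auto
    have "(\<Sum>g\<in>{g \<in> S - {\<one>}. conj_class G g = A}. Q (conj_class G g)) =
        (\<Sum>g\<in>{g \<in> S - {\<one>}. conj_class G g = A}. Q A)"
      by (intro sum.cong) auto
    then show "(\<Sum>g\<in>{g \<in> S - {\<one>}. conj_class G g = A}. Q (conj_class G g)) = of_nat (card (A \<inter> S)) * Q A"
      unfolding e by simp
  qed
  finally show ?thesis .
qed

section \<open>Character values, orthogonality and completeness\<close>

lemma IrrE:
  assumes "c \<in> Irr G"
  obtains \<rho> where "\<rho> \<in> c" "is_irr_rep G (irr_dim G c) \<rho>"
    "\<And>g. g \<in> carrier G \<Longrightarrow> irr_char c g = mat_trace (\<rho> g)"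
proof -
  obtain \<rho> where \<rho>: "\<rho> \<in> irr_reps G" "c = irr_rep_equiv G `` {\<rho>}"
    using assms by (auto simp: Irr_def elim: quotientE)
  then have "\<rho> \<in> c" using equiv_class_self[OF equiv_irr_rep_equiv] by blast
  moreover obtain n where "is_irr_rep G n \<rho>" using \<rho> by (auto simp: irr_reps_def)
  ultimately show thesis using that irr_dim_eq[OF group_axioms assms] irr_char_eq[OF assms] by metis
qed

lemma irr_rep_in_Irr:
  assumes "is_irr_rep G n \<rho>"
  obtains c where "c \<in> Irr G" "\<And>g. g \<in> carrier G \<Longrightarrow> irr_char c g = mat_trace (\<rho> g)"
proof -
  let ?c = "irr_rep_equiv G `` {\<rho>}"
  have r: "\<rho> \<in> irr_reps G" using assms by (auto simp: irr_reps_def)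
  then have "?c \<in> Irr G" "\<rho> \<in> ?c"
    using equiv_class_self[OF equiv_irr_rep_equiv r] by (auto simp: Irr_def quotientI)
  then show thesis using that irr_char_eq by metis
qed

lemma irr_char_inv: "c \<in> Irr G \<Longrightarrow> g \<in> carrier G \<Longrightarrow> irr_char c (inv g) = cnj (irr_char c g)"
  by (erule IrrE) (simp add: mat_trace_rep_inv[OF fin is_irr_rep_rep])

lemma cmod_irr_char_le: "c \<in> Irr G \<Longrightarrow> g \<in> carrier G \<Longrightarrow> cmod (irr_char c g) \<le> real (irr_dim G c)"
  by (erule IrrE) (simp add: cmod_trace_rep_le[OF fin is_irr_rep_rep])

lemma irr_char_conj:
  "c \<in> Irr G \<Longrightarrow> g \<in> carrier G \<Longrightarrow> x \<in> carrier G \<Longrightarrow> irr_char c (g \<otimes> x \<otimes> inv g) = irr_char c x"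
  by (erule IrrE) (simp add: mat_trace_rep_conj[OF is_irr_rep_rep])

lemma irr_char_conj_class:
  "c \<in> Irr G \<Longrightarrow> h \<in> carrier G \<Longrightarrow> x \<in> conj_class G h \<Longrightarrow> irr_char c x = irr_char c h"
  by (auto simp: conj_class_eq irr_char_conj)

lemma irr_char_one: "c \<in> Irr G \<Longrightarrow> irr_char c \<one> = of_nat (irr_dim G c)"
  by (erule IrrE) (simp add: is_rep_one[OF is_irr_rep_rep] mat_trace_def)

lemma irr_dim_pos: "c \<in> Irr G \<Longrightarrow> 0 < irr_dim G c"
  by (erule IrrE) (simp add: is_irr_rep_def)

text \<open>Conjugates are rewritten as values at inverses, the form of the trace relations;
  distinct members of \<open>Irr G\<close> have inequivalent representatives.\<close>

lemma irr_char_orthogonal: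
  assumes c: "c \<in> Irr G" and d: "d \<in> Irr G"
  shows "(\<Sum>g\<in>carrier G. irr_char c g * cnj (irr_char d g)) =
    (if c = d then of_real (real (Coset.order G)) else 0)"
proof -
  obtain \<rho> where \<rho>: "\<rho> \<in> c" "is_irr_rep G (irr_dim G c) \<rho>"
    "\<And>g. g \<in> carrier G \<Longrightarrow> irr_char c g = mat_trace (\<rho> g)" using IrrE[OF c] by blast
  obtain \<sigma> where \<sigma>: "\<sigma> \<in> d" "is_irr_rep G (irr_dim G d) \<sigma>"
    "\<And>g. g \<in> carrier G \<Longrightarrow> irr_char d g = mat_trace (\<sigma> g)" using IrrE[OF d] by blast
  show ?thesis
  proof (cases "c = d")
    case True
    have "(\<Sum>g\<in>carrier G. irr_char c g * cnj (irr_char d g)) =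
      (\<Sum>g\<in>carrier G. mat_trace (\<rho> g) * mat_trace (\<rho> (inv g)))"
      using True c by (intro sum.cong refl) (simp add: irr_char_inv[symmetric] \<rho>(3)[symmetric])
    with True trace_orthonormal[OF fin \<rho>(2)] show ?thesis by simp
  next
    case False
    then have "(\<rho>, \<sigma>) \<notin> irr_rep_equiv G"
      using quotient_eq_iff[OF equiv_irr_rep_equiv c[unfolded Irr_def] d[unfolded Irr_def] \<rho>(1) \<sigma>(1)] by simp
    moreover have "(\<Sum>g\<in>carrier G. irr_char c g * cnj (irr_char d g)) =
      (\<Sum>g\<in>carrier G. mat_trace (\<rho> g) * mat_trace (\<sigma> (inv g)))"
      using d by (intro sum.cong refl) (simp add: irr_char_inv[symmetric] \<rho>(3)[symmetric] \<sigma>(3)[symmetric])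
    ultimately show ?thesis using False trace_orthogonal[OF \<rho>(2) \<sigma>(2)] by simp
  qed
qed

lemma order_pos: "0 < real (Coset.order G)"
  using fin by (simp add: order_gt_0_iff_finite)

text \<open>Bessel's inequality for the indicator of the identity bounds the sum of the squared
  dimensions over any finite \<open>S\<close> by the group order. Each dimension is at least 1, so
  \<open>S\<close> has at most that many members.\<close>

lemma finite_Irr: "finite (Irr G)"
proof (rule finite_if_finite_subsets_card_bdd[THEN conjunct1])
  fix S assume S: "S \<subseteq> Irr G" "finite S"
  have "real (card S) \<le> (\<Sum>c\<in>S. (real (irr_dim G c))\<^sup>2)"
    using S irr_dim_pos sum_mono[of S "\<lambda>_. 1" "\<lambda>c. (real (irr_dim G c))\<^sup>2"]
    by (auto simp: Suc_le_eq subset_iff)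
  also have "\<dots> = (\<Sum>c\<in>S. (cmod (\<Sum>g\<in>carrier G. (if g = \<one> then 1 else 0) * cnj (irr_char c g)))\<^sup>2)"
  proof (intro sum.cong refl)
    fix c assume "c \<in> S"
    then have c: "c \<in> Irr G" using S by auto
    have "(\<Sum>g\<in>carrier G. (if g = \<one> then 1 else 0) * cnj (irr_char c g)) =
      (\<Sum>g\<in>carrier G. if g = \<one> then cnj (irr_char c \<one>) else 0)" by (intro sum.cong) auto
    also have "\<dots> = of_nat (irr_dim G c)" using fin irr_char_one[OF c] by simp
    finally show "(real (irr_dim G c))\<^sup>2 =
      (cmod (\<Sum>g\<in>carrier G. (if g = \<one> then 1 else 0) * cnj (irr_char c g)))\<^sup>2" by simp
  qed
  also have "\<dots> \<le> real (Coset.order G) * (\<Sum>g\<in>carrier G. (cmod (if g = \<one> then 1 else 0))\<^sup>2)"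
    using S(1) by (intro bessel[OF S(2) order_pos] irr_char_orthogonal) auto
  also have "(\<Sum>g\<in>carrier G. (cmod (if g = \<one> then 1 else 0))\<^sup>2) = (\<Sum>g\<in>carrier G. if g = \<one> then 1 else 0 :: real)"
    by (intro sum.cong) auto
  also have "\<dots> = 1" using fin by simp
  finally show "card S \<le> Coset.order G" by simp
qed

text \<open>Bessel's inequality for the indicator of the class of \<open>h\<close>: each coefficient
  is the class size times the conjugate of \<open>irr_char c h\<close>, while the squared norm of
  the indicator is the class size.\<close>

lemma sum_irr_char_sq_le:
  assumes h: "h \<in> carrier G"
  shows "(\<Sum>c\<in>Irr G. (cmod (irr_char c h))\<^sup>2) \<le> real (Coset.order G) / real (card (conj_class G h))"
proof -
  let ?A = "conj_class G h" and ?\<phi> = "\<lambda>g. if g \<in> conj_class G h then 1 else 0 :: complex"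
  have A: "carrier G \<inter> ?A = ?A" using conj_class_subset[OF h] by auto
  have "(\<Sum>c\<in>Irr G. (cmod (\<Sum>g\<in>carrier G. ?\<phi> g * cnj (irr_char c g)))\<^sup>2) \<le>
      real (Coset.order G) * (\<Sum>g\<in>carrier G. (cmod (?\<phi> g))\<^sup>2)"
    by (rule bessel[OF finite_Irr order_pos]) (rule irr_char_orthogonal)
  also have "(\<Sum>g\<in>carrier G. (cmod (?\<phi> g))\<^sup>2) = (\<Sum>g\<in>carrier G. if g \<in> ?A then 1 else 0)"
    by (intro sum.cong) auto
  also have "\<dots> = real (card ?A)" using fin by (simp add: sum.If_cases A)
  also have "(\<Sum>c\<in>Irr G. (cmod (\<Sum>g\<in>carrier G. ?\<phi> g * cnj (irr_char c g)))\<^sup>2) =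
    (\<Sum>c\<in>Irr G. (real (card ?A))\<^sup>2 * (cmod (irr_char c h))\<^sup>2)"
  proof (intro sum.cong refl)
    fix c assume c: "c \<in> Irr G"
    have "(\<Sum>g\<in>carrier G. ?\<phi> g * cnj (irr_char c g)) = (\<Sum>g\<in>carrier G. if g \<in> ?A then cnj (irr_char c h) else 0)"
      using irr_char_conj_class[OF c h] by (intro sum.cong) auto
    also have "\<dots> = of_nat (card ?A) * cnj (irr_char c h)" using fin by (simp add: sum.If_cases A)
    finally show "(cmod (\<Sum>g\<in>carrier G. ?\<phi> g * cnj (irr_char c g)))\<^sup>2 = (real (card ?A))\<^sup>2 * (cmod (irr_char c h))\<^sup>2"
      by (simp add: norm_mult power_mult_distrib)
  qed
  finally have "(real (card ?A))\<^sup>2 * (\<Sum>c\<in>Irr G. (cmod (irr_char c h))\<^sup>2) \<le> real (Coset.order G) * real (card ?A)"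
    by (simp add: sum_distrib_left)
  then show ?thesis using card_conj_class_pos[OF h] by (simp add: field_simps power2_eq_square)
qed

text \<open>The residual of \<open>\<phi>\<close> is again a class function and is orthogonal to all
  irreducible characters, so completeness makes it vanish.\<close>

lemma parseval_class_function:
  fixes \<phi> :: "'a \<Rightarrow> complex"
  assumes cl: "\<And>g x. g \<in> carrier G \<Longrightarrow> x \<in> carrier G \<Longrightarrow> \<phi> (g \<otimes> x \<otimes> inv g) = \<phi> x"
  shows "(\<Sum>c\<in>Irr G. (cmod (\<Sum>g\<in>carrier G. \<phi> g * cnj (irr_char c g)))\<^sup>2) =
    real (Coset.order G) * (\<Sum>g\<in>carrier G. (cmod (\<phi> g))\<^sup>2)"
proof -
  define a where "a c = (\<Sum>g\<in>carrier G. \<phi> g * cnj (irr_char c g))" for c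
  define \<psi> where "\<psi> x = \<phi> x - (\<Sum>c\<in>Irr G. a c / of_real (real (Coset.order G)) * irr_char c x)" for x
  have \<psi>0: "\<psi> x = 0" if x: "x \<in> carrier G" for x
  proof -
    \<comment> \<open>Completeness is stated for pairings with unconjugated characters; inverting
      the argument supplies the conjugates.\<close>
    have "\<psi> (inv (inv x)) = 0"
    proof (rule class_function_zero[of "\<lambda>g. \<psi> (inv g)"])
      fix g x assume gx: "g \<in> carrier G" "x \<in> carrier G"
      have "inv (g \<otimes> x \<otimes> inv g) = g \<otimes> inv x \<otimes> inv g"
        using gx by (simp add: inv_mult_group m_assoc)
      then show "\<psi> (inv (g \<otimes> x \<otimes> inv g)) = \<psi> (inv x)"
        using gx cl[of g "inv x"] irr_char_conj[of _ g "inv x"] by (simp add: \<psi>_def)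
    next
      fix n \<sigma> assume "is_irr_rep G n \<sigma>"
      then obtain c where c: "c \<in> Irr G" "\<And>g. g \<in> carrier G \<Longrightarrow> irr_char c g = mat_trace (\<sigma> g)"
        using irr_rep_in_Irr by blast
      have "(\<Sum>g\<in>carrier G. \<psi> (inv g) * mat_trace (\<sigma> g)) = (\<Sum>g\<in>carrier G. \<psi> (inv g) * cnj (irr_char c (inv g)))"
        using c irr_char_inv[OF c(1)] by (intro sum.cong refl) simp
      also have "\<dots> = (\<Sum>g\<in>carrier G. \<psi> g * cnj (irr_char c g))"
        by (rule sum.reindex_bij_betw[of "\<lambda>g. inv g"]) (rule bij_betwI[of _ _ _ "\<lambda>g. inv g"], auto)
      also have "\<dots> = 0"
        unfolding \<psi>_def a_def by (rule residual_orthogonal[OF finite_Irr order_pos irr_char_orthogonal c(1)])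
      finally show "(\<Sum>g\<in>carrier G. \<psi> (inv g) * mat_trace (\<sigma> g)) = 0" .
    qed (use x in simp)
    then show ?thesis using x by simp
  qed
  have "(\<Sum>x\<in>carrier G. (cmod (\<psi> x))\<^sup>2) =
    (\<Sum>x\<in>carrier G. (cmod (\<phi> x))\<^sup>2) - (\<Sum>c\<in>Irr G. (cmod (a c))\<^sup>2) / real (Coset.order G)"
    unfolding \<psi>_def a_def by (rule residual_norm[OF finite_Irr order_pos irr_char_orthogonal])
  then show ?thesis using \<psi>0 order_pos by (simp add: a_def[symmetric] field_simps)
qed

section \<open>The two bounds\<close>

lemma D_sub_le:
  assumes H: "H \<subseteq> carrier G"
  shows "D_sub G H \<le> (\<Sum>h \<in> H - {\<one>}. real (card (conj_class G h)) powr (- (1/2)))"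
proof -
  let ?n = "real (Coset.order G)"
  have bound: "(\<Sum>c\<in>Irr G. real (irr_dim G c) * cmod (irr_char c h)) \<le>
      ?n * real (card (conj_class G h)) powr (- (1/2))" if h: "h \<in> carrier G" for h
  proof -
    let ?k = "real (card (conj_class G h))"
    \<comment> \<open>The weight that balances the two halves of the weighted AM-GM inequality
      below: since \<open>t * t = 1 / ?k\<close>, both halves are then bounded by
      \<open>?n * t\<close>.\<close>
    define t where "t = ?k powr (- (1/2))"
    have k: "?k > 0" using card_conj_class_pos[OF h] by simp
    then have t: "t > 0" by (simp add: t_def)
    have "t * t = 1 / ?k" using k by (simp add: t_def powr_minus_divide flip: powr_add)
    then have kt: "1 / ?k / t = t" using t by (metis nonzero_mult_div_cancel_right less_irrefl)
    \<comment> \<open>The character bound at the identity, whose class has one element.\<close>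
    have d: "(\<Sum>c\<in>Irr G. (real (irr_dim G c))\<^sup>2) \<le> ?n"
      using sum_irr_char_sq_le[OF one_closed] conj_class_eq_one[of \<one>] by (simp add: irr_char_one)
    \<comment> \<open>Applied term by term with this optimal weight, it gives the Cauchy-Schwarz
      estimate.\<close>
    have amgm: "x * y \<le> (t * x\<^sup>2 + y\<^sup>2 / t) / 2" for x y :: real
    proof -
      have "0 \<le> (t * x - y)\<^sup>2 / t" using t by simp
      also have "\<dots> = t * x\<^sup>2 + y\<^sup>2 / t - 2 * (x * y)"
        using t by (simp add: field_simps power2_eq_square)
      finally show ?thesis by simp
    qed
    have "(\<Sum>c\<in>Irr G. real (irr_dim G c) * cmod (irr_char c h)) \<le>
      (\<Sum>c\<in>Irr G. (t * (real (irr_dim G c))\<^sup>2 + (cmod (irr_char c h))\<^sup>2 / t) / 2)"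
      by (intro sum_mono amgm)
    also have "\<dots> = (t * (\<Sum>c\<in>Irr G. (real (irr_dim G c))\<^sup>2) + (\<Sum>c\<in>Irr G. (cmod (irr_char c h))\<^sup>2) / t) / 2"
      by (simp add: sum.distrib sum_distrib_left add_divide_distrib flip: sum_divide_distrib)
    also have "\<dots> \<le> (t * ?n + ?n / ?k / t) / 2"
      using d sum_irr_char_sq_le[OF h] t by (intro divide_right_mono add_mono mult_left_mono) auto
    also have "\<dots> = ?n * t" using arg_cong[OF kt, of "\<lambda>x. ?n * x"] by simp
    finally show ?thesis unfolding t_def .
  qed
  have "?n * D_sub G H = (\<Sum>c\<in>Irr G. real (irr_dim G c) * cmod (\<Sum>h\<in>H - {\<one>}. irr_char c h))"
    using order_pos by (simp add: D_sub_def)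
  also have "\<dots> \<le> (\<Sum>c\<in>Irr G. real (irr_dim G c) * (\<Sum>h\<in>H - {\<one>}. cmod (irr_char c h)))"
    by (intro sum_mono mult_left_mono norm_sum) auto
  also have "\<dots> = (\<Sum>h\<in>H - {\<one>}. \<Sum>c\<in>Irr G. real (irr_dim G c) * cmod (irr_char c h))"
    unfolding sum_distrib_left by (rule sum.swap)
  also have "\<dots> \<le> (\<Sum>h\<in>H - {\<one>}. ?n * real (card (conj_class G h)) powr (- (1/2)))"
    using H by (intro sum_mono bound) auto
  also have "\<dots> = ?n * (\<Sum>h\<in>H - {\<one>}. real (card (conj_class G h)) powr (- (1/2)))"
    by (simp add: sum_distrib_left)
  finally show ?thesis using order_pos by simp
qed

lemma sum_irr_char_subset_sq:
  assumes H: "H \<subseteq> carrier G"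
  shows "(\<Sum>c\<in>Irr G. (cmod (\<Sum>h\<in>H - {\<one>}. irr_char c h))\<^sup>2) =
    real (Coset.order G) * (\<Sum>A\<in>nonid_conj_classes G. (real (card (A \<inter> H)))\<^sup>2 / real (card A))"
proof -
  define q where "q A = real (card (A \<inter> H)) / real (card A)" for A
  \<comment> \<open>The identity gets 0 because the sums run over \<open>H - {\<one>}\<close>.
    Elsewhere the mass of \<open>A \<inter> H\<close> is spread evenly over the class
    \<open>A\<close>.\<close>
  define \<phi> where "\<phi> g = (if g = \<one> then 0 else q (conj_class G g))" for g
  have pos: "card A > 0 \<and> A \<inter> carrier G = A" if "A \<in> nonid_conj_classes G" for A
    using that card_conj_class_pos conj_class_subset by (auto simp: nonid_conj_classes_def)
  have cl: "complex_of_real (\<phi> (g \<otimes> x \<otimes> inv g)) = of_real (\<phi> x)"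
    if gx: "g \<in> carrier G" "x \<in> carrier G" for g x
  proof -
    have "g \<otimes> x \<otimes> inv g \<in> conj_class G x" using gx by (auto simp: conj_class_eq)
    then have e: "conj_class G (g \<otimes> x \<otimes> inv g) = conj_class G x" by (rule conj_class_cong[OF gx(2)])
    then have "g \<otimes> x \<otimes> inv g = \<one> \<longleftrightarrow> x = \<one>"
      using conj_class_eq_one[of x] conj_class_eq_one[of "g \<otimes> x \<otimes> inv g"] gx by simp
    then show ?thesis by (simp add: \<phi>_def e)
  qed
  have drop1: "(\<Sum>g\<in>carrier G. F g) = (\<Sum>g\<in>carrier G - {\<one>}. F g)" if "F \<one> = 0"
    for F :: "'a \<Rightarrow> 'c :: comm_monoid_add"
    using that fin by (intro sum.mono_neutral_right) auto
  have coef: "cmod (\<Sum>g\<in>carrier G. of_real (\<phi> g) * cnj (irr_char c g)) = cmod (\<Sum>h\<in>H - {\<one>}. irr_char c h)"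
    if c: "c \<in> Irr G" for c
  proof -
    \<comment> \<open>The class average expresses the character value as a function of the class,
      the form that \<open>sum_conj_class\<close> requires.\<close>
    define Q where "Q A = (\<Sum>x\<in>A. irr_char c x) / of_nat (card A)" for A
    have Q: "Q (conj_class G h) = irr_char c h" if h: "h \<in> carrier G" for h
      using irr_char_conj_class[OF c h] card_conj_class_pos[OF h] by (simp add: Q_def)
    have "(\<Sum>g\<in>carrier G. of_real (\<phi> g) * irr_char c g) = (\<Sum>g\<in>carrier G - {\<one>}. of_real (\<phi> g) * irr_char c g)"
      by (rule drop1) (simp add: \<phi>_def)
    also have "\<dots> = (\<Sum>g\<in>carrier G - {\<one>}. of_real (q (conj_class G g)) * Q (conj_class G g))"
      by (intro sum.cong refl) (simp add: \<phi>_def Q)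
    also have "\<dots> = (\<Sum>A\<in>nonid_conj_classes G. of_nat (card (A \<inter> carrier G)) * (of_real (q A) * Q A))"
      by (rule sum_conj_class) simp
    \<comment> \<open>The class size cancels the denominator of \<open>q\<close>, leaving the
      weights that arise from summing over \<open>H\<close> alone.\<close>
    also have "\<dots> = (\<Sum>A\<in>nonid_conj_classes G. of_nat (card (A \<inter> H)) * Q A)"
      using pos by (intro sum.cong refl) (auto simp: q_def)
    also have "\<dots> = (\<Sum>h\<in>H - {\<one>}. Q (conj_class G h))"
      by (rule sum_conj_class[OF H, symmetric])
    also have "\<dots> = (\<Sum>h\<in>H - {\<one>}. irr_char c h)" using H Q by (intro sum.cong) auto
    finally have "cnj (\<Sum>g\<in>carrier G. of_real (\<phi> g) * irr_char c g) = cnj (\<Sum>h\<in>H - {\<one>}. irr_char c h)"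
      by simp
    then have "(\<Sum>g\<in>carrier G. of_real (\<phi> g) * cnj (irr_char c g)) = cnj (\<Sum>h\<in>H - {\<one>}. irr_char c h)"
      by simp
    then show ?thesis by (metis complex_mod_cnj)
  qed
  have "(\<Sum>c\<in>Irr G. (cmod (\<Sum>h\<in>H - {\<one>}. irr_char c h))\<^sup>2) =
    real (Coset.order G) * (\<Sum>g\<in>carrier G. (cmod (complex_of_real (\<phi> g)))\<^sup>2)"
    using parseval_class_function[of "\<lambda>g. of_real (\<phi> g)", OF cl] by (simp only: coef cong: sum.cong)
  also have "(\<Sum>g\<in>carrier G. (cmod (complex_of_real (\<phi> g)))\<^sup>2) = (\<Sum>g\<in>carrier G - {\<one>}. (cmod (complex_of_real (\<phi> g)))\<^sup>2)"
    by (rule drop1) (simp add: \<phi>_def)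
  also have "\<dots> = (\<Sum>g\<in>carrier G - {\<one>}. (q (conj_class G g))\<^sup>2)"
    by (intro sum.cong refl) (simp add: \<phi>_def)
  also have "\<dots> = (\<Sum>A\<in>nonid_conj_classes G. of_nat (card (A \<inter> carrier G)) * (q A)\<^sup>2)"
    by (rule sum_conj_class) simp
  also have "\<dots> = (\<Sum>A\<in>nonid_conj_classes G. (real (card (A \<inter> H)))\<^sup>2 / real (card A))"
    using pos by (intro sum.cong refl) (auto simp: q_def power2_eq_square)
  finally show ?thesis .
qed

text \<open>A nontrivial element of \<open>H\<close> makes the class sum \<open>s\<close> positive,
  and the estimate with factor |H| - 1 then forces \<open>D_sub G H > 0\<close>.\<close>

lemma D_sub_gt:
  assumes H: "subgroup H G" "H \<noteq> {\<one>}"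
  shows "(\<Sum>A\<in>nonid_conj_classes G. (real (card (A \<inter> H)))\<^sup>2 / (real (card H) * real (card A))) < D_sub G H"
proof -
  let ?n = "real (Coset.order G)" and ?h = "real (card H)"
  define s where "s = (\<Sum>A\<in>nonid_conj_classes G. (real (card (A \<inter> H)))\<^sup>2 / real (card A))"
  define a where "a c = cmod (\<Sum>h\<in>H - {\<one>}. irr_char c h)" for c
  have Hc: "H \<subseteq> carrier G" and H1: "\<one> \<in> H" using H(1) by (auto dest: subgroup.subset subgroup.one_closed)
  then have Hf: "finite H" using fin finite_subset by blast
  obtain x where x: "x \<in> H" "x \<noteq> \<one>" using H(2) H1 by auto
  have card1: "real (card (H - {\<one>})) = ?h - 1"
    using Hf H1 card_gt_0_iff[of H] by (auto simp: of_nat_diff)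
  have h1: "?h - 1 > 0" unfolding card1[symmetric] using x Hf by (auto simp: card_gt_0_iff)
  have s: "s > 0" unfolding s_def
  proof (rule sum_pos2[OF finite_nonid_conj_classes])
    show "conj_class G x \<in> nonid_conj_classes G"
      using x Hc conj_class_eq_one[of x] by (auto simp: nonid_conj_classes_def)
    have "x \<in> conj_class G x \<inter> H" using x Hc conj_class_self by auto
    then have "card (conj_class G x \<inter> H) > 0" using Hf by (auto simp: card_gt_0_iff)
    then show "0 < (real (card (conj_class G x \<inter> H)))\<^sup>2 / real (card (conj_class G x))"
      using card_conj_class_pos[of x] x Hc by auto
  qed auto
  have "?n * s = (\<Sum>c\<in>Irr G. (a c)\<^sup>2)"
    using sum_irr_char_subset_sq[OF Hc] by (simp add: s_def a_def)
  also have "\<dots> \<le> (\<Sum>c\<in>Irr G. (?h - 1) * (real (irr_dim G c) * a c))"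
  proof (rule sum_mono)
    fix c assume c: "c \<in> Irr G"
    have "a c \<le> (\<Sum>h\<in>H - {\<one>}. real (irr_dim G c))"
      unfolding a_def by (rule sum_norm_le) (use cmod_irr_char_le[OF c] Hc in auto)
    also have "\<dots> = (?h - 1) * real (irr_dim G c)" by (simp add: card1 del: card_Diff_insert)
    finally have "a c * a c \<le> ((?h - 1) * real (irr_dim G c)) * a c"
      by (rule mult_right_mono) (simp add: a_def)
    then show "(a c)\<^sup>2 \<le> (?h - 1) * (real (irr_dim G c) * a c)"
      by (simp add: power2_eq_square mult.assoc)
  qed
  also have "\<dots> = ?n * ((?h - 1) * D_sub G H)"
    using order_pos by (simp add: D_sub_def a_def sum_distrib_left)
  finally have "s \<le> (?h - 1) * D_sub G H" using order_pos by simp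
  then have "0 < (?h - 1) * D_sub G H" using s by linarith
  then have "D_sub G H > 0" using h1 by (simp add: zero_less_mult_iff)
  \<comment> \<open>Raising the factor from |H| - 1 to |H| adds one positive copy of
    \<open>D_sub G H\<close>; this is the source of strictness.\<close>
  then have "s < ?h * D_sub G H" using \<open>s \<le> _\<close> by (simp add: algebra_simps)
  then have "s / ?h < D_sub G H" using h1 by (simp add: field_simps)
  then show ?thesis unfolding s_def sum_divide_distrib by (simp add: mult.commute)
qed

end

text \<open>For trivial \<open>H\<close> both sides of the first inequality are 0, so strictness is
  asserted for nontrivial \<open>H\<close> only. The sums over indices are reindexed by the
  bijection \<open>C\<close> into sums over the set of classes.\<close>

theorem proposition1:
  fixes G :: "('a, 'b) monoid_scheme" and H :: "'a set" and C :: "nat \<Rightarrow> 'a set" and k :: nat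
  assumes "group G" and "finite (carrier G)"
    and "subgroup H G"
    and "bij_betw C {1..k} (nonid_conj_classes G)"
  shows "(H \<noteq> {\<one>\<^bsub>G\<^esub>} \<longrightarrow>
           (\<Sum>i = 1..k. (real (card (C i \<inter> H)))\<^sup>2 / (real (card H) * real (card (C i)))) < D_sub G H)
       \<and> D_sub G H \<le> (\<Sum>i = 1..k. real (card (C i \<inter> H)) * real (card (C i)) powr (- (1/2)))
       \<and> (\<Sum>i = 1..k. real (card (C i \<inter> H)) * real (card (C i)) powr (- (1/2)))
           = (\<Sum>h \<in> H - {\<one>\<^bsub>G\<^esub>}. real (card (conj_class G h)) powr (- (1/2)))"
proof -
  interpret finite_group G using assms(1,2) by (simp add: finite_group_def finite_group_axioms_def)
  have H: "H \<subseteq> carrier G" using assms(3) by (rule subgroup.subset)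
  have eq: "(\<Sum>i = 1..k. real (card (C i \<inter> H)) * real (card (C i)) powr (- (1/2)))
      = (\<Sum>h \<in> H - {\<one>\<^bsub>G\<^esub>}. real (card (conj_class G h)) powr (- (1/2)))"
    unfolding sum_conj_class[OF H, of "\<lambda>A. real (card A) powr (- (1/2))"]
    by (rule sum.reindex_bij_betw[OF assms(4)])
  have "(\<Sum>i = 1..k. (real (card (C i \<inter> H)))\<^sup>2 / (real (card H) * real (card (C i)))) =
      (\<Sum>A\<in>nonid_conj_classes G. (real (card (A \<inter> H)))\<^sup>2 / (real (card H) * real (card A)))"
    by (rule sum.reindex_bij_betw[OF assms(4)])
  with eq show ?thesis using D_sub_gt[OF assms(3)] D_sub_le[OF H] by simp
qed

end
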